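(* Let $p$ be a prime. There exists $\gamma>0$ such that for all $\alpha>0$ there exists $c$ for which the following holds. Let $X$ and $Y$ be subsets of two intervals $I$ and $J$ of $\mathbb{Z}_p$ respectively (so $X\subset I$, $Y\subset J$), and let $1 \leq c_1 \leq |X|$ and $1 \leq c_2 \leq |Y|$ be integers such that $c_1c_2 \geq c\max(|X|,|Y|)$. Suppose that $\alpha |J| \leq |I| \leq \alpha^{-1}|J|$, $|I| +|J| \leq p$ and $\max(|I\setminus X|, |J \setminus Y| ) \leq \gamma \min(|I|, |J|)$. Then there exist $X' \in X^{(c_1)}$ and $Y' \in Y^{(c_2)}$ such that $|X'+Y'| \geq |X|+|Y|-1$.
   Context: An interval in $\mathbb{Z}_p$ is a set of consecutive residues $\{a, a+1, \dots, a+m-1\}$. For a finite set $S$ and integer $m$, $S^{(m)}$ denotes the family of all $m$-element subsets of $S$. $X'+Y'$ denotes the sumset. *)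

theory Defs
  imports "HOL-Number_Theory.Number_Theory" "HOL-Algebra.AbelCoset" "HOL-Library.Ramsey"
begin

(* The residues mod p are the carrier {0..p-1} of residue_ring p; an interval may wrap around. *)
definition residue_interval :: "nat \<Rightarrow> int set \<Rightarrow> bool" where
  "residue_interval p I \<longleftrightarrow>
     (\<exists>(a::int) (m::nat). I = (\<lambda>i. (a + int i) mod int p) ` {..<m})"

end

theory Submission
  imports Defs "HOL-Library.Set_Algebras"
begin

text \<open>
  Since the two intervals have total length at most \<open>p\<close>, there is no wrap-around and one may work with
  \<open>X \<subseteq> [0, m)\<close> and \<open>Y \<subseteq> [0, n)\<close> in the integers, where the number of sums that are missed must not
  exceed the total number of holes of \<open>X\<close> and \<open>Y\<close>. Fix \<open>L = R 4\<^sup>J\<close> of order \<open>min(m, n)\<close> such that \<open>2\<^sup>J\<close> and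
  \<open>R 2\<^sup>J\<close> are of order \<open>c\<^sub>1\<close> and \<open>c\<^sub>2\<close>.

  A sum \<open>s\<close> in the middle has about \<open>L\<close> representations, few of which are spoilt by holes. Adding a random
  block of \<open>X\<close> of length \<open>2\<^sup>J\<close> to a random residue class of \<open>Y\<close> modulo \<open>2\<^sup>J\<close>, and repeating this a
  bounded number of times, loses only a small multiple of the number of holes.

  At the left end (the right one is its mirror image) call \<open>(a, b)\<close> jointly dense if the holes of \<open>X\<close> after
  \<open>a\<close> and of \<open>Y\<close> after \<open>b\<close> have small density at every scale. From such a pair the random construction
  applied at geometrically growing scales covers \<open>a + b + [0, 4L)\<close> at a small cost, so what remains is to
  make up for the \<open>t = |X \<inter> [0, a)| + |Y \<inter> [0, b)|\<close> elements in front of it. Greedily chosen sums collect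
  them, together with a surplus, at some \<open>r \<ge> 8t\<close>; if this fails for all \<open>r\<close>, then \<open>X\<close> and \<open>Y\<close> are so full
  near \<open>a\<close> and \<open>b\<close> that there is a jointly dense pair with smaller \<open>t\<close>.
\<close>


section \<open>Holes\<close>

definition holes :: "int set \<Rightarrow> int \<Rightarrow> int \<Rightarrow> real" where
  "holes A u v = real (card ({u..<v} - A))"

lemma holes_nonneg [simp]: "0 \<le> holes A u v"
  by (simp add: holes_def)

lemma holes_empty_interval [simp]: "v \<le> u \<Longrightarrow> holes A u v = 0"
  by (simp add: holes_def)

lemma holes_split:
  assumes "u \<le> v" "v \<le> w"
  shows "holes A u w = holes A u v + holes A v w"
proof -
  have "{u..<w} - A = ({u..<v} - A) \<union> ({v..<w} - A)" "({u..<v} - A) \<inter> ({v..<w} - A) = {}"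
    using assms by auto
  then show ?thesis by (simp add: holes_def card_Un_disjoint)
qed

lemma holes_mono: "u' \<le> u \<Longrightarrow> v \<le> v' \<Longrightarrow> holes A u v \<le> holes A u' v'"
  unfolding holes_def by (intro of_nat_mono card_mono) auto

lemma holes_antimono: "A \<subseteq> B \<Longrightarrow> holes B u v \<le> holes A u v"
  unfolding holes_def by (intro of_nat_mono card_mono) auto

lemma card_Int_interval:
  assumes "u \<le> v"
  shows "real (card (A \<inter> {u..<v})) = of_int (v - u) - holes A u v"
  using card_Int_Diff[of "{u..<v}" A] assms by (simp add: holes_def Int_commute)

lemma card_Int_interval_ge: "of_int (v - u) - holes A u v \<le> real (card (A \<inter> {u..<v}))"
  using card_Int_interval[of u v A] by (cases "u \<le> v") auto

lemma card_Int_interval_add_le: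
  assumes "0 \<le> d"
  shows "real (card (A \<inter> {u..<v + d})) \<le> real (card (A \<inter> {u..<v})) + of_int d"
proof -
  have "A \<inter> {u..<v + d} \<subseteq> (A \<inter> {u..<v}) \<union> {v..<v + d}" by auto
  then have "card (A \<inter> {u..<v + d}) \<le> card ((A \<inter> {u..<v}) \<union> {v..<v + d})" by (intro card_mono) auto
  also have "\<dots> \<le> card (A \<inter> {u..<v}) + card {v..<v + d}" by (rule card_Un_le)
  finally show ?thesis using assms by simp
qed

lemma card_subset_interval:
  assumes "A \<subseteq> {u..<v}" "u \<le> v"
  shows "real (card A) = of_int (v - u) - holes A u v"
  using card_Int_interval[OF assms(2), of A] assms(1) by (simp add: Int_absorb2)

lemma holes_adjacent_le:
  assumes "S \<subseteq> {u..<v}" "S' \<subseteq> {v..<w}" "u \<le> v" "v \<le> w" "S \<union> S' \<subseteq> W"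
  shows "holes W u w \<le> of_int (w - u) - real (card S) - real (card S')"
proof -
  have "holes W u w = holes W u v + holes W v w" using assms by (intro holes_split)
  also have "\<dots> \<le> holes S u v + holes S' v w" using assms by (intro add_mono holes_antimono) auto
  finally show ?thesis using assms by (simp add: card_subset_interval)
qed

lemma holes_reflect: "holes ((-) (c - 1) ` A) u v = holes A (c - v) (c - u)"
proof -
  have "(-) (c - 1) ` ({u..<v} - (-) (c - 1) ` A) = {c - 1 - v<..c - 1 - u} - A"
    by (simp add: image_set_diff image_image inj_on_def)
  also have "\<dots> = {c - v..<c - u} - A" by auto
  finally have "(-) (c - 1) ` ({u..<v} - (-) (c - 1) ` A) = {c - v..<c - u} - A" .
  moreover have "inj_on ((-) (c - 1)) B" for B by (simp add: inj_on_def)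
  ultimately show ?thesis unfolding holes_def by (metis card_image)
qed

lemma holes_translate_le:
  assumes "(+) a ` (A \<inter> {u..<v}) \<subseteq> T"
  shows "holes T (a + u) (a + v) \<le> holes A u v"
proof -
  have "{a + u..<a + v} - T \<subseteq> (+) a ` ({u..<v} - A)"
  proof
    fix z assume z: "z \<in> {a + u..<a + v} - T"
    then have "z - a \<notin> A" using imageI[of "z - a" "A \<inter> {u..<v}" "(+) a"] assms by auto
    then show "z \<in> (+) a ` ({u..<v} - A)" using z by (intro image_eqI[of _ _ "z - a"]) auto
  qed
  then show ?thesis unfolding holes_def by (intro of_nat_mono surj_card_le) auto
qed

definition pair_holes :: "int set \<Rightarrow> int set \<Rightarrow> int \<Rightarrow> int \<Rightarrow> int \<Rightarrow> int \<Rightarrow> real" where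
  "pair_holes A B a b s t = holes A (a + s) (a + t) + holes B (b + s) (b + t)"

lemma pair_holes_nonneg [simp]: "0 \<le> pair_holes A B a b s t"
  by (simp add: pair_holes_def)

lemma pair_holes_commute: "pair_holes A B a b s t = pair_holes B A b a s t"
  by (simp add: pair_holes_def)

lemma pair_holes_shift: "pair_holes A B (a + i) (b + i) s t = pair_holes A B a b (i + s) (i + t)"
  by (simp add: pair_holes_def add.assoc)

lemma pair_holes_split:
  assumes "s \<le> t" "t \<le> u"
  shows "pair_holes A B a b s u = pair_holes A B a b s t + pair_holes A B a b t u"
  using assms holes_split[of "a + s" "a + t" "a + u" A] holes_split[of "b + s" "b + t" "b + u" B]
  by (simp add: pair_holes_def)

lemma pair_holes_mono:
  assumes "a' + s' \<le> a + s" "a + t \<le> a' + t'" "b' + s' \<le> b + s" "b + t \<le> b' + t'"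
  shows "pair_holes A B a b s t \<le> pair_holes A B a' b' s' t'"
  unfolding pair_holes_def by (rule add_mono; rule holes_mono; rule assms)

definition jointly_dense :: "int set \<Rightarrow> int set \<Rightarrow> int \<Rightarrow> int \<Rightarrow> int \<Rightarrow> bool" where
  "jointly_dense A B M a b \<longleftrightarrow> (\<forall>s\<in>{0..M}. 32 * pair_holes A B a b 0 s \<le> of_int s)"

lemma jointly_denseD:
  assumes "jointly_dense A B M a b" "0 \<le> s" "s \<le> M"
  shows "32 * pair_holes A B a b 0 s \<le> of_int s"
    and "32 * holes A a (a + s) \<le> of_int s" and "32 * holes B b (b + s) \<le> of_int s"
proof -
  show pair_le: "32 * pair_holes A B a b 0 s \<le> of_int s" using assms by (simp add: jointly_dense_def)
  have "holes A a (a + s) \<le> pair_holes A B a b 0 s" "holes B b (b + s) \<le> pair_holes A B a b 0 s"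
    by (simp_all add: pair_holes_def)
  with pair_le show "32 * holes A a (a + s) \<le> of_int s" "32 * holes B b (b + s) \<le> of_int s" by linarith+
qed

lemma jointly_dense_antimono: "jointly_dense A B M a b \<Longrightarrow> M' \<le> M \<Longrightarrow> jointly_dense A B M' a b"
  by (simp add: jointly_dense_def)

lemma jointly_dense_commute: "jointly_dense A B M a b \<longleftrightarrow> jointly_dense B A M b a"
  by (simp add: jointly_dense_def pair_holes_commute)

text \<open>Every bad \<open>i\<close> starts a jump \<open>s\<close> over which \<open>F\<close> gains more than \<open>s\<close>; these jumps, taken greedily from
  the left, cover all bad points.\<close>

lemma rising_sun:
  fixes F :: "int \<Rightarrow> real"
  assumes "mono_on {i..} F" "i \<le> n + M" "0 \<le> M"
  shows "real (card {j \<in> {i..<n}. \<exists>s\<in>{1..M}. of_int s < F (j + s) - F j}) \<le> F (n + M) - F i"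
  using assms(1,2)
proof (induction "nat (n + M - i)" arbitrary: i rule: less_induct)
  case less
  define bad where "bad = (\<lambda>i. {j \<in> {i..<n}. \<exists>s\<in>{1..M}. of_int s < F (j + s) - F j})"
  have finite_bad: "finite (bad i)" for i
    by (rule finite_subset[of _ "{i..<n}"]) (auto simp: bad_def)
  have "real (card (bad i)) \<le> F (n + M) - F i"
  proof (cases "i < n")
    case False
    then have "bad i = {}" by (auto simp: bad_def)
    then show ?thesis using less.prems by (simp add: mono_on_def)
  next
    case True
    obtain s where s: "1 \<le> s" "i + s \<le> n + M"
      and gain: "real (card (bad i \<inter> {i..<i + s})) \<le> F (i + s) - F i"
    proof (cases "i \<in> bad i")
      case True
      then obtain s where s: "1 \<le> s" "s \<le> M" "of_int s < F (i + s) - F i" by (auto simp: bad_def)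
      have "card (bad i \<inter> {i..<i + s}) \<le> card {i..<i + s}" by (intro card_mono) auto
      then show ?thesis using s \<open>i < n\<close> by (intro that[of s]) auto
    next
      case False
      then have "bad i \<inter> {i..<i + 1} = {}" by (auto simp: order.antisym zless_add1_eq)
      then show ?thesis using less.prems \<open>i < n\<close> assms(3)
        by (intro that[of 1]) (auto simp: mono_on_def)
    qed
    have "bad i \<subseteq> (bad i \<inter> {i..<i + s}) \<union> bad (i + s)" by (auto simp: bad_def)
    then have "card (bad i) \<le> card ((bad i \<inter> {i..<i + s}) \<union> bad (i + s))"
      using finite_bad by (intro card_mono) auto
    also have "\<dots> \<le> card (bad i \<inter> {i..<i + s}) + card (bad (i + s))" by (rule card_Un_le)
    finally have "real (card (bad i)) \<le> F (i + s) - F i + real (card (bad (i + s)))" using gain by linarith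
    also have "real (card (bad (i + s))) \<le> F (n + M) - F (i + s)"
      unfolding bad_def using s less.prems by (intro less.hyps) (auto intro: mono_on_subset)
    finally show ?thesis by simp
  qed
  then show ?case by (simp add: bad_def)
qed

lemma exists_jointly_dense:
  assumes "0 \<le> M" "0 \<le> n" and few: "32 * pair_holes A B a b 0 (n + M) < of_int n"
  obtains i where "0 \<le> i" "i < n" "jointly_dense A B M (a + i) (b + i)"
proof -
  define F where "F = (\<lambda>j. 32 * pair_holes A B a b 0 j)"
  define bad where "bad = {j \<in> {0..<n}. \<exists>s\<in>{1..M}. of_int s < F (j + s) - F j}"
  have "real (card bad) \<le> F (n + M) - F 0"
    unfolding bad_def using assms
    by (intro rising_sun) (auto simp: F_def mono_on_def intro: pair_holes_mono)
  also have "\<dots> < of_int n" using few by (simp add: F_def pair_holes_def)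
  finally have "bad \<noteq> {0..<n}" using assms(2) by auto
  moreover have "bad \<subseteq> {0..<n}" by (auto simp: bad_def)
  ultimately obtain i where i: "i \<in> {0..<n}" "i \<notin> bad" by blast
  have "32 * pair_holes A B (a + i) (b + i) 0 s \<le> of_int s" if s: "s \<in> {0..M}" for s
  proof (cases "s = 0")
    case False
    then have "s \<in> {1..M}" using s by auto
    then have "F (i + s) - F i \<le> of_int s" using i by (auto simp: bad_def not_less)
    then show ?thesis
      using i s pair_holes_split[of 0 i "i + s" A B a b] by (simp add: F_def pair_holes_shift)
  qed (simp add: pair_holes_def)
  then show thesis using i by (intro that[of i]) (auto simp: jointly_dense_def)
qed

section \<open>Sumsets of few elements\<close>

definition small_sumsets :: "'a::plus set \<Rightarrow> 'a set \<Rightarrow> real \<Rightarrow> real \<Rightarrow> 'a set set" where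
  "small_sumsets X Y k l = {X' + Y' | X' Y'. X' \<subseteq> X \<and> Y' \<subseteq> Y \<and> finite X' \<and> finite Y' \<and>
     real (card X') \<le> k \<and> real (card Y') \<le> l}"

lemma small_sumsetsI:
  "X' \<subseteq> X \<Longrightarrow> Y' \<subseteq> Y \<Longrightarrow> finite X' \<Longrightarrow> finite Y' \<Longrightarrow> real (card X') \<le> k \<Longrightarrow> real (card Y') \<le> l
    \<Longrightarrow> X' + Y' \<in> small_sumsets X Y k l"
  by (auto simp: small_sumsets_def)

lemma small_sumsetsE:
  assumes "S \<in> small_sumsets X Y k l"
  obtains X' Y' where "S = X' + Y'" "X' \<subseteq> X" "Y' \<subseteq> Y" "finite X'" "finite Y'"
    "real (card X') \<le> k" "real (card Y') \<le> l"
  using assms by (auto simp: small_sumsets_def)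

lemma empty_mem_small_sumsets: "0 \<le> k \<Longrightarrow> 0 \<le> l \<Longrightarrow> {} \<in> small_sumsets X Y k l"
  using small_sumsetsI[of "{}" X "{}" Y k l] by simp

lemma small_sumsets_mono:
  "X \<subseteq> X1 \<Longrightarrow> Y \<subseteq> Y1 \<Longrightarrow> k \<le> k1 \<Longrightarrow> l \<le> l1 \<Longrightarrow> S \<in> small_sumsets X Y k l \<Longrightarrow> S \<in> small_sumsets X1 Y1 k1 l1"
  by (fastforce simp: small_sumsets_def)

lemma small_sumsets_subset_plus: "S \<in> small_sumsets X Y k l \<Longrightarrow> S \<subseteq> X + Y"
  by (auto simp: small_sumsets_def set_plus_def)

lemma small_sumsets_commute:
  fixes X Y :: "'a::ab_semigroup_add set"
  shows "small_sumsets X Y k l = small_sumsets Y X l k"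
proof -
  have "S \<in> small_sumsets Y X l k" if "S \<in> small_sumsets X Y k l" for S and X Y :: "'a set" and k l
  proof -
    from that obtain X' Y' where "S = X' + Y'" "X' \<subseteq> X" "Y' \<subseteq> Y" "finite X'" "finite Y'"
      "real (card X') \<le> k" "real (card Y') \<le> l" by (rule small_sumsetsE)
    then show ?thesis using small_sumsetsI[of Y' Y X' X l k] by (simp add: add.commute[of X'])
  qed
  then show ?thesis by blast
qed

lemma small_sumsets_Un:
  assumes "S \<in> small_sumsets X Y k l" "T \<in> small_sumsets X Y k' l'"
  obtains W where "W \<in> small_sumsets X Y (k + k') (l + l')" "S \<subseteq> W" "T \<subseteq> W"
proof -
  from assms obtain X1 Y1 X2 Y2 where S: "S = X1 + Y1" "X1 \<subseteq> X" "Y1 \<subseteq> Y" "finite X1" "finite Y1"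
      "real (card X1) \<le> k" "real (card Y1) \<le> l"
    and T: "T = X2 + Y2" "X2 \<subseteq> X" "Y2 \<subseteq> Y"
      "finite X2" "finite Y2" "real (card X2) \<le> k'" "real (card Y2) \<le> l'"
    by (metis small_sumsetsE)
  show thesis
  proof (rule that)
    show "(X1 \<union> X2) + (Y1 \<union> Y2) \<in> small_sumsets X Y (k + k') (l + l')"
      using S T card_Un_le[of X1 X2] card_Un_le[of Y1 Y2] by (intro small_sumsetsI) auto
  qed (auto simp: S T set_plus_def)
qed

lemma small_sumsets_finite: "S \<in> small_sumsets X Y k l \<Longrightarrow> finite S"
  by (auto simp: small_sumsets_def intro: finite_set_plus)

lemma small_sumsets_extend:
  assumes "S \<in> small_sumsets X Y k l" "finite X" "finite Y"
    and "k \<le> real c\<^sub>1" "c\<^sub>1 \<le> card X" "l \<le> real c\<^sub>2" "c\<^sub>2 \<le> card Y"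
  obtains X' Y' where "X' \<subseteq> X" "Y' \<subseteq> Y" "card X' = c\<^sub>1" "card Y' = c\<^sub>2" "S \<subseteq> X' + Y'"
proof -
  obtain X1 Y1 where S: "S = X1 + Y1" "X1 \<subseteq> X" "Y1 \<subseteq> Y" "real (card X1) \<le> k" "real (card Y1) \<le> l"
    using assms(1) by (rule small_sumsetsE)
  have "card X1 \<le> c\<^sub>1" "card Y1 \<le> c\<^sub>2" using S assms by linarith+
  then obtain X' Y' where "X1 \<subseteq> X'" "X' \<subseteq> X" "card X' = c\<^sub>1" "Y1 \<subseteq> Y'" "Y' \<subseteq> Y" "card Y' = c\<^sub>2"
    using exists_subset_between[of X1 c\<^sub>1 X] exists_subset_between[of Y1 c\<^sub>2 Y] S assms by auto
  then show thesis using S(1) set_plus_mono2[of X1 X' Y1 Y'] by (intro that[of X' Y']) auto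
qed

lemma small_sumsets_iterate:
  assumes "finite Z" "0 \<le> \<delta>"
    and step: "\<And>Z'. Z' \<subseteq> Z \<Longrightarrow> \<exists>S\<in>small_sumsets X Y k l. real (card (Z' - S)) \<le> \<delta> * real (card Z')"
  shows "\<exists>S\<in>small_sumsets X Y (real K * k) (real K * l). real (card (Z - S)) \<le> \<delta> ^ K * real (card Z)"
proof (induction K)
  case 0
  show ?case by (rule bexI[of _ "{}"]) (auto simp: empty_mem_small_sumsets)
next
  case (Suc K)
  then obtain S where S: "S \<in> small_sumsets X Y (real K * k) (real K * l)"
    "real (card (Z - S)) \<le> \<delta> ^ K * real (card Z)" by blast
  obtain T where T: "T \<in> small_sumsets X Y k l" "real (card (Z - S - T)) \<le> \<delta> * real (card (Z - S))"
    using step[of "Z - S"] by auto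
  obtain W where W: "W \<in> small_sumsets X Y (real K * k + k) (real K * l + l)" "S \<subseteq> W" "T \<subseteq> W"
    using small_sumsets_Un[OF S(1) T(1)] by blast
  have "card (Z - W) \<le> card (Z - S - T)" using W \<open>finite Z\<close> by (intro card_mono) auto
  also have "real (card (Z - S - T)) \<le> \<delta> * (\<delta> ^ K * real (card Z))"
    using T(2) mult_left_mono[OF S(2) \<open>0 \<le> \<delta>\<close>] by linarith
  finally have "real (card (Z - W)) \<le> \<delta> ^ Suc K * real (card Z)" by simp
  then show ?case using W(1) by (auto simp: algebra_simps)
qed

lemma reflect_sumset:
  fixes A B :: "'a::ab_group_add set"
  shows "(-) c ` A + (-) d ` B = (-) (c + d) ` (A + B)"
proof -
  have "(c - x) + (d - y) = (c + d) - (x + y)" for x y by (simp add: algebra_simps)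
  then show ?thesis unfolding set_plus_image by (force simp: image_iff)
qed

lemma reflect_mem_small_sumsets:
  fixes X Y :: "'a::ab_group_add set"
  assumes "S \<in> small_sumsets ((-) c ` X) ((-) d ` Y) k l"
  shows "(-) (c + d) ` S \<in> small_sumsets X Y k l"
proof -
  from assms obtain X' Y' where S: "S = X' + Y'" "X' \<subseteq> (-) c ` X" "Y' \<subseteq> (-) d ` Y" "finite X'" "finite Y'"
    "real (card X') \<le> k" "real (card Y') \<le> l" by (rule small_sumsetsE)
  have "(-) c ` X' + (-) d ` Y' \<in> small_sumsets X Y k l"
    using S(2-) card_image_le[of X' "(-) c"] card_image_le[of Y' "(-) d"] by (intro small_sumsetsI) auto
  then show ?thesis by (simp add: reflect_sumset S(1))
qed

lemma exists_card_slice_le_average: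
  fixes N :: real
  assumes "finite A" "finite B" "A \<noteq> {}" and col: "\<And>b. b \<in> B \<Longrightarrow> real (card {a \<in> A. R a b}) \<le> N"
  shows "\<exists>a\<in>A. real (card A) * real (card {b \<in> B. R a b}) \<le> real (card B) * N"
proof (rule ccontr)
  assume "\<not> ?thesis"
  then have "(\<Sum>a\<in>A. real (card B) * N) < (\<Sum>a\<in>A. real (card A) * real (card {b \<in> B. R a b}))"
    using assms(1,3) by (intro sum_strict_mono) (auto simp: not_le)
  also have "\<dots> = real (card A) * real (\<Sum>a\<in>A. card {b \<in> B. R a b})" by (simp add: sum_distrib_left)
  also have "(\<Sum>a\<in>A. card {b \<in> B. R a b}) = (\<Sum>b\<in>B. card {a \<in> A. R a b})"
    using assms(1,2) by (intro sum_multicount_gen) auto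
  also have "real \<dots> \<le> real (card B) * N" using sum_mono[OF col] by simp
  finally show False by (simp add: mult_left_mono)
qed

lemma exists_translate_overlap_le:
  fixes U V W :: "'a::cancel_semigroup_add set"
  assumes "finite U" "finite V" "finite W" "V \<noteq> {}"
  shows "\<exists>v\<in>V. real (card V) * real (card {u \<in> U. u + v \<in> W}) \<le> real (card U) * real (card W)"
proof (rule exists_card_slice_le_average)
  fix u
  have "card {v \<in> V. u + v \<in> W} \<le> card W"
    using \<open>finite W\<close> by (intro card_inj_on_le[of "(+) u"]) (auto simp: inj_on_def)
  then show "real (card {v \<in> V. u + v \<in> W}) \<le> real (card W)" by simp
qed (use assms in auto)

lemma card_sumset_insert_ge:
  fixes U V :: "'a::cancel_semigroup_add set"
  assumes "finite U" "finite V"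
  shows "card (U + V) + card U \<le> card (U + insert v V) + card {u \<in> U. u + v \<in> U + V}"
proof -
  define new where "new = (\<lambda>u. u + v) ` {u \<in> U. u + v \<notin> U + V}"
  have "card U = card {u \<in> U. u + v \<in> U + V} + card {u \<in> U. u + v \<notin> U + V}"
    using card_Int_Diff[OF \<open>finite U\<close>, of "{u. u + v \<in> U + V}"] by (simp add: Int_def set_diff_eq)
  also have "card {u \<in> U. u + v \<notin> U + V} = card new"
    unfolding new_def by (rule card_image[symmetric]) (simp add: inj_on_def)
  finally have "card (U + V) + card U = card ((U + V) \<union> new) + card {u \<in> U. u + v \<in> U + V}"
    using assms by (subst card_Un_disjoint) (auto simp: new_def finite_set_plus)
  also have "card ((U + V) \<union> new) \<le> card (U + insert v V)"
    using assms by (intro card_mono finite_set_plus) (auto simp: new_def set_plus_def)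
  finally show ?thesis by simp
qed

text \<open>As long as \<open>U + V'\<close> is smaller than \<open>(1 - e) |V|\<close>, the average \<open>v \<in> V\<close> contributes at least \<open>e |U|\<close> new
  sums.\<close>

lemma greedy_sumset:
  fixes U V :: "'a::cancel_semigroup_add set" and e :: real
  assumes U: "finite U" and V: "finite V" and e: "0 \<le> e" "e \<le> 1"
  shows "\<exists>V'\<subseteq>V. card V' \<le> M \<and>
           min ((1 - e) * real (card V)) (real M * e * real (card U)) \<le> real (card (U + V'))"
proof (induction M)
  case 0
  show ?case using e by (intro exI[of _ "{}"]) auto
next
  case (Suc M)
  then obtain V' where V': "V' \<subseteq> V" "card V' \<le> M"
    "min ((1 - e) * real (card V)) (real M * e * real (card U)) \<le> real (card (U + V'))" by blast
  show ?case
  proof (cases "(1 - e) * real (card V) \<le> real (card (U + V'))")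
    case True
    then show ?thesis using V' by (intro exI[of _ V']) auto
  next
    case False
    have "finite V'" using V V' finite_subset by blast
    have Vpos: "0 < card V" using False by (cases "card V") auto
    then obtain v where v: "v \<in> V"
      "real (card V) * real (card {u \<in> U. u + v \<in> U + V'}) \<le> real (card U) * real (card (U + V'))"
      using exists_translate_overlap_le[OF U V finite_set_plus[OF U \<open>finite V'\<close>]] by fastforce
    have "real (card U) * real (card (U + V')) \<le> real (card U) * ((1 - e) * real (card V))"
      using False by (intro mult_left_mono) auto
    with v(2) have "real (card V) * real (card {u \<in> U. u + v \<in> U + V'})
      \<le> real (card V) * ((1 - e) * real (card U))"
      by (simp add: mult_ac)
    then have "real (card {u \<in> U. u + v \<in> U + V'}) \<le> (1 - e) * real (card U)" using Vpos by simp
    moreover have "real M * e * real (card U) \<le> real (card (U + V'))" using V' False by linarith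
    ultimately have "real (Suc M) * e * real (card U) \<le> real (card (U + insert v V'))"
      using card_sumset_insert_ge[OF U \<open>finite V'\<close>, of v] by (simp add: algebra_simps)
    moreover have "card (insert v V') \<le> Suc M" using V' card_insert_le_m1[of "Suc M" V' v] by simp
    ultimately show ?thesis using V' v by (intro exI[of _ "insert v V'"]) auto
  qed
qed

section \<open>Covering from a window\<close>

lemma card_residue_class_le:
  fixes d \<rho> y0 :: int
  assumes "0 < d"
  shows "card {y \<in> {y0..<y0 + d * int q}. y mod d = \<rho>} \<le> q"
proof -
  let ?C = "{y \<in> {y0..<y0 + d * int q}. y mod d = \<rho>}"
  have "inj_on (\<lambda>y. (y - y0) div d) ?C"
  proof (rule inj_onI)
    fix x y assume "x \<in> ?C" "y \<in> ?C" and quotients_eq: "(x - y0) div d = (y - y0) div d"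
    then have "(x - y0) mod d = (y - y0) mod d" by (auto intro: mod_diff_cong)
    with quotients_eq have "x - y0 = y - y0" by (metis div_mult_mod_eq)
    then show "x = y" by simp
  qed
  moreover have "(y - y0) div d \<in> {0..<int q}" if "y \<in> ?C" for y
  proof -
    have "(y - y0) div d * d \<le> y - y0"
      using assms by (simp add: minus_mod_eq_div_mult[symmetric])
    also have "\<dots> < int q * d" using that by (simp add: mult.commute)
    finally show ?thesis using that assms by (simp add: pos_imp_zdiv_nonneg_iff)
  qed
  ultimately have "card ?C \<le> card {0..<int q}" by (intro card_inj_on_le[of "\<lambda>y. (y - y0) div d"]) auto
  then show ?thesis by simp
qed

lemma exists_block_element_with_residue:
  fixes d N \<beta> \<rho> s w :: int
  assumes d: "0 < d" and \<beta>: "0 \<le> \<beta>" "\<beta> < N" and \<rho>: "0 \<le> \<rho>" "\<rho> < d"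
  obtains u where "u \<in> {w..<w + d * N}" "u \<in> {w + d * \<beta>..<w + d * \<beta> + d}"
    "(u - w) div d = \<beta>" "(s - u) mod d = \<rho>"
proof -
  define t where "t = (s - w - d * \<beta> - \<rho>) mod d"
  define u where "u = w + d * \<beta> + t"
  have t: "0 \<le> t" "t < d" using d by (auto simp: t_def)
  have "(s - u) mod d = (s - w - d * \<beta> - t) mod d" by (simp add: u_def algebra_simps)
  also have "\<dots> = (s - w - d * \<beta> - (s - w - d * \<beta> - \<rho>)) mod d"
    unfolding t_def by (rule mod_diff_right_eq)
  also have "\<dots> = \<rho>" using \<rho> by simp
  finally have residue: "(s - u) mod d = \<rho>" .
  have block: "(u - w) div d = \<beta>" using t d by (simp add: u_def)
  have "d * \<beta> + d \<le> d * N" using \<beta> d mult_left_mono[of "\<beta> + 1" N d] by (simp add: algebra_simps)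
  moreover have "0 \<le> d * \<beta>" using \<beta> d by simp
  ultimately show thesis using t residue block by (intro that[of u]) (simp_all add: u_def)
qed

definition block_residue_sumset ::
    "int set \<Rightarrow> int set \<Rightarrow> nat \<Rightarrow> int \<Rightarrow> int \<Rightarrow> int \<Rightarrow> int set" where
  "block_residue_sumset X Y k w \<beta> \<rho> =
     (X \<inter> {w + int k * \<beta>..<w + int k * \<beta> + int k}) + {y \<in> Y. y mod int k = \<rho>}"

lemma block_residue_sumset_mem_small_sumsets:
  assumes "0 < k" "Y \<subseteq> {y0..<y0 + int k * int q}"
  shows "block_residue_sumset X Y k w \<beta> \<rho> \<in> small_sumsets X Y (real k) (real q)"
proof -
  let ?I = "{y0..<y0 + int k * int q}"
  have "card (X \<inter> {w + int k * \<beta>..<w + int k * \<beta> + int k}) \<le> card {w + int k * \<beta>..<w + int k * \<beta> + int k}"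
    by (intro card_mono) auto
  moreover have "card {y \<in> Y. y mod int k = \<rho>} \<le> card {y \<in> ?I. y mod int k = \<rho>}"
    by (rule card_mono, rule finite_subset[OF Collect_restrict]) (use assms(2) in auto)
  then have "card {y \<in> Y. y mod int k = \<rho>} \<le> q"
    using card_residue_class_le[of "int k" y0 q \<rho>] assms(1) by simp
  moreover have "finite Y" using assms(2) finite_subset by blast
  ultimately show ?thesis
    unfolding block_residue_sumset_def by (intro small_sumsetsI of_nat_mono) auto
qed

text \<open>A uniformly random block of length \<open>k\<close> of the window together with a uniformly random residue class
  modulo \<open>k\<close> singles out, for each target \<open>s\<close>, one uniformly random representation \<open>s = u + (s - u)\<close> with \<open>u\<close>
  in the window.\<close>

lemma card_missing_block_residue_le:
  assumes k: "0 < k" and L: "L = int (k * l)"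
  shows "card {q \<in> {0..<int l} \<times> {0..<int k}. s \<notin> block_residue_sumset X Y k w (fst q) (snd q)}
    \<le> card {u \<in> {w..<w + L}. u \<notin> X \<or> s - u \<notin> Y}"
    (is "card ?pairs \<le> card ?missing")
proof -
  have "?pairs \<subseteq> (\<lambda>u. ((u - w) div int k, (s - u) mod int k)) ` ?missing"
  proof
    fix q assume q: "q \<in> ?pairs"
    then have "0 < int k" "0 \<le> fst q" "fst q < int l" "0 \<le> snd q" "snd q < int k" using k by auto
    then obtain u where u: "u \<in> {w..<w + int k * int l}"
        "u \<in> {w + int k * fst q..<w + int k * fst q + int k}"
      and indices: "(u - w) div int k = fst q" "(s - u) mod int k = snd q"
      by (rule exists_block_element_with_residue)
    have "u \<in> X \<Longrightarrow> s - u \<in> Y \<Longrightarrow> u + (s - u) \<in> block_residue_sumset X Y k w (fst q) (snd q)"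
      unfolding block_residue_sumset_def using u indices by (intro set_plus_intro) auto
    then have "u \<in> ?missing" using q u(1) by (auto simp: L)
    then show "q \<in> (\<lambda>u. ((u - w) div int k, (s - u) mod int k)) ` ?missing"
      using indices by (intro image_eqI[of _ _ u]) auto
  qed
  then show ?thesis by (rule surj_card_le[rotated]) (rule finite_subset[OF Collect_restrict], simp)
qed

lemma block_residue_cover:
  fixes X Y Z :: "int set" and k l c :: nat and L w z0 :: int and \<delta> :: real
  assumes k: "0 < k" and l: "0 < l" and L: "L = int (k * l)" and Z: "Z \<subseteq> {z0..<z0 + int c * L}"
    and missing: "\<And>s. s \<in> Z \<Longrightarrow> real (card {u \<in> {w..<w + L}. u \<notin> X \<or> s - u \<notin> Y}) \<le> \<delta> * of_int L"
  shows "\<exists>S\<in>small_sumsets X Y (real k) (real ((c + 1) * l)). real (card (Z - S)) \<le> \<delta> * real (card Z)"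
proof -
  define P where "P = {0..<int l} \<times> {0..<int k}"
  define y0 where "y0 = z0 - w - L"
  define Y' where "Y' = Y \<inter> {y0..<y0 + int k * int ((c + 1) * l)}"
  define S where "S = (\<lambda>q. block_residue_sumset X Y' k w (fst q) (snd q))"
  have few_missed: "real (card {q \<in> P. s \<notin> S q}) \<le> \<delta> * of_int L" if s: "s \<in> Z" for s
  proof -
    have "s - u \<in> {y0..<y0 + int k * int ((c + 1) * l)}" if "u \<in> {w..<w + L}" for u
      using that s Z by (auto simp: y0_def L algebra_simps)
    then have "{u \<in> {w..<w + L}. u \<notin> X \<or> s - u \<notin> Y'} = {u \<in> {w..<w + L}. u \<notin> X \<or> s - u \<notin> Y}"
      by (auto simp: Y'_def)
    then have "card {u \<in> {w..<w + L}. u \<notin> X \<or> s - u \<notin> Y'} = card {u \<in> {w..<w + L}. u \<notin> X \<or> s - u \<notin> Y}"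
      by (rule arg_cong)
    then show ?thesis
      using missing[OF s] card_missing_block_residue_le[OF k L, of s X Y' w]
      unfolding P_def S_def by linarith
  qed
  have "finite P" "P \<noteq> {}" "finite Z" using k l Z finite_subset by (auto simp: P_def)
  from exists_card_slice_le_average[OF this(1,3,2) few_missed]
  obtain q where "q \<in> P" and average: "real (card P) * real (card {s \<in> Z. s \<notin> S q})
      \<le> real (card Z) * (\<delta> * of_int L)"
    by (rule bexE)
  have "real (card P) = of_int L" "0 < L" using k l by (simp_all add: P_def L)
  then have "real (card (Z - S q)) \<le> \<delta> * real (card Z)" using average by (simp add: set_diff_eq mult_ac)
  moreover have "S q \<in> small_sumsets X Y' (real k) (real ((c + 1) * l))"
    unfolding S_def Y'_def using k by (rule block_residue_sumset_mem_small_sumsets) (rule Int_lower2)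
  then have "S q \<in> small_sumsets X Y (real k) (real ((c + 1) * l))"
    by (rule small_sumsets_mono[rotated -1]) (auto simp: Y'_def)
  ultimately show ?thesis by blast
qed

lemma card_missing_representations_le:
  "real (card {u \<in> {w..<w + L}. u \<notin> X \<or> s - u \<notin> Y})
    \<le> holes X w (w + L) + holes Y (s - w - L + 1) (s - w + 1)"
proof -
  have "{u \<in> {w..<w + L}. u \<notin> X \<or> s - u \<notin> Y}
    \<subseteq> ({w..<w + L} - X) \<union> (-) s ` ({s - w - L + 1..<s - w + 1} - Y)"
    (is "?missing \<subseteq> ?holes")
  proof
    fix u assume "u \<in> ?missing"
    then show "u \<in> ?holes" by (cases "u \<in> X") (auto intro: image_eqI[of _ _ "s - u"])
  qed
  then have "card {u \<in> {w..<w + L}. u \<notin> X \<or> s - u \<notin> Y}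
      \<le> card (({w..<w + L} - X) \<union> (-) s ` ({s - w - L + 1..<s - w + 1} - Y))"
    by (intro card_mono) auto
  also have "\<dots> \<le> card ({w..<w + L} - X) + card ((-) s ` ({s - w - L + 1..<s - w + 1} - Y))"
    by (rule card_Un_le)
  also have "card ((-) s ` ({s - w - L + 1..<s - w + 1} - Y)) \<le> card ({s - w - L + 1..<s - w + 1} - Y)"
    by (rule card_image_le) simp
  finally show ?thesis by (simp add: holes_def)
qed

lemma window_cover:
  fixes X Y Z :: "int set" and k l c :: nat and L w z0 :: int
  assumes k: "0 < k" and l: "0 < l" and L: "L = int (k * l)" and Z: "Z \<subseteq> {z0..<z0 + int c * L}"
    and h: "holes X w (w + L) + holes Y (z0 - w - L + 1) (z0 + int c * L - w) \<le> h"
  shows "\<exists>S\<in>small_sumsets X Y (real (K * k)) (real (K * ((c + 1) * l))).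
           real (card (Z - S)) \<le> (h / of_int L) ^ K * real (card Z)"
proof -
  have "0 < L" using k l by (simp add: L)
  have "0 \<le> h" using h by (rule order_trans[rotated]) (simp add: add_nonneg_nonneg)
  have "real (card {u \<in> {w..<w + L}. u \<notin> X \<or> s - u \<notin> Y}) \<le> h / of_int L * of_int L" if "s \<in> Z" for s
  proof -
    have "z0 \<le> s" "s < z0 + int c * L" using that Z by auto
    then have "holes Y (s - w - L + 1) (s - w + 1) \<le> holes Y (z0 - w - L + 1) (z0 + int c * L - w)"
      by (intro holes_mono) auto
    then show ?thesis using card_missing_representations_le[of w L X s Y] h \<open>0 < L\<close> by simp
  qed
  then have "\<exists>S\<in>small_sumsets X Y (real k) (real ((c + 1) * l)).
      real (card (Z' - S)) \<le> h / of_int L * real (card Z')"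
    if "Z' \<subseteq> Z" for Z'
    using that Z by (intro block_residue_cover[OF k l L, of _ z0 c w]) auto
  moreover have "finite Z" using Z finite_subset by blast
  ultimately show ?thesis
    using small_sumsets_iterate[of Z "h / of_int L" X Y "real k" "real ((c + 1) * l)" K] \<open>0 \<le> h\<close> \<open>0 < L\<close>
    by (simp only: of_nat_mult zero_le_divide_iff) simp
qed

lemma ratio_power_mult_le:
  fixes h s :: real
  assumes "0 \<le> h" "h \<le> s / 2" "0 < s" "0 < K"
  shows "(h / s) ^ K * s \<le> 2 / 2 ^ K * h"
proof -
  obtain K' where K: "K = Suc K'" using assms(4) by (cases K) auto
  have "(h / s) ^ K * s = (h / s) ^ K' * h" using assms(3) by (simp add: K)
  also have "\<dots> \<le> (1 / 2) ^ K' * h"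
    using assms by (intro mult_right_mono power_mono) (auto simp: field_simps)
  finally show ?thesis by (simp add: K power_one_over)
qed

section \<open>Covering forwards from a jointly dense pair\<close>

lemma jointly_dense_imp_mem:
  assumes "jointly_dense A B M a b" "1 \<le> M"
  shows "a \<in> A"
proof -
  have "holes A a (a + 1) < 1" using jointly_denseD(2)[OF assms(1), of 1] assms(2) by simp
  then have "card ({a..<a + 1} - A) = 0" by (simp add: holes_def)
  then show ?thesis by auto
qed

lemma translate_subset_small_sumset:
  fixes X Y :: "int set" and a b :: int
  assumes "a \<in> X"
  obtains T where "T \<in> small_sumsets X Y 1 (real n)" "(+) a ` (Y \<inter> {b..<b + int n}) \<subseteq> T"
proof
  have "card (Y \<inter> {b..<b + int n}) \<le> card {b..<b + int n}" by (intro card_mono) auto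
  then show "{a} + (Y \<inter> {b..<b + int n}) \<in> small_sumsets X Y 1 (real n)"
    using assms by (intro small_sumsetsI) auto
qed auto

lemma first_window_cover:
  fixes X Y :: "int set" and a b :: int and R K :: nat
  assumes R: "0 < R" and K: "0 < K" and dense: "jointly_dense X Y (4 * int R) a b"
  shows "\<exists>T\<in>small_sumsets X Y (real (2 * K)) (real (13 * K * R)).
     (+) a ` (Y \<inter> {b..<b + int R}) \<subseteq> T \<and>
     holes T (a + b + int R) (a + b + 4 * int R) \<le> 24 / 2 ^ K * pair_holes X Y a b (int R) (4 * int R)"
proof -
  let ?z = "a + b + int R"
  have "a \<in> X" using jointly_dense_imp_mem[OF dense] R by simp
  then obtain T1 where T1: "T1 \<in> small_sumsets X Y 1 (real (4 * R))"
    "(+) a ` (Y \<inter> {b..<b + int (4 * R)}) \<subseteq> T1" by (rule translate_subset_small_sumset)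
  define Z where "Z = {?z..<?z + int 3 * int R} - T1"
  have "(+) a ` (Y \<inter> {b + int R..<b + 4 * int R}) \<subseteq> T1" using T1(2) by auto
  then have "holes T1 ?z (a + b + 4 * int R) \<le> holes Y (b + int R) (b + 4 * int R)"
    using holes_translate_le[of a Y "b + int R" "b + 4 * int R"] by (simp add: add.assoc)
  moreover have "?z + int 3 * int R = a + b + 4 * int R" by simp
  then have "real (card Z) = holes T1 ?z (a + b + 4 * int R)" by (simp only: Z_def holes_def)
  ultimately have card_Z: "real (card Z) \<le> pair_holes X Y a b (int R) (4 * int R)"
    by (simp add: pair_holes_def add_increasing)
  have "holes X a (a + int R) + holes Y (?z - a - int R + 1) (?z + int 3 * int R - a)
      \<le> pair_holes X Y a b 0 (4 * int R)"
    unfolding pair_holes_def by (rule add_mono; rule holes_mono) auto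
  also have "\<dots> \<le> of_int (int R) / 8" using jointly_denseD(1)[OF dense, of "4 * int R"] R by simp
  finally have few_holes: "holes X a (a + int R) + holes Y (?z - a - int R + 1) (?z + int 3 * int R - a)
      \<le> of_int (int R) / 8" .
  have "int R = int (1 * R)" "Z \<subseteq> {?z..<?z + int 3 * int R}" by (auto simp: Z_def)
  from window_cover[OF zero_less_one R this few_holes, of K]
  obtain T2 where T2: "T2 \<in> small_sumsets X Y (real (K * 1)) (real (K * ((3 + 1) * R)))"
    "real (card (Z - T2)) \<le> (of_int (int R) / 8 / of_int (int R)) ^ K * real (card Z)"
    by blast
  obtain T where T: "T \<in> small_sumsets X Y (1 + real (K * 1)) (real (4 * R) + real (K * ((3 + 1) * R)))"
    "T1 \<subseteq> T" "T2 \<subseteq> T" using small_sumsets_Un[OF T1(1) T2(1)] by blast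
  have "holes T ?z (a + b + 4 * int R) \<le> real (card (Z - T2))"
    unfolding holes_def using T by (intro of_nat_mono card_mono) (auto simp: Z_def)
  also have "\<dots> \<le> (1 / 8) ^ K * real (card Z)" using T2(2) R by simp
  also have "\<dots> \<le> 24 / 2 ^ K * pair_holes X Y a b (int R) (4 * int R)"
  proof (rule mult_mono)
    show "(1 / 8 :: real) ^ K \<le> 24 / 2 ^ K"
      using power_mono[of 2 "8 :: real" K] zero_le_power[of "8 :: real" K]
      by (simp add: power_one_over field_simps del: zero_le_power)
  qed (use card_Z in auto)
  finally have loss: "holes T ?z (a + b + 4 * int R)
      \<le> 24 / 2 ^ K * pair_holes X Y a b (int R) (4 * int R)" .
  have "1 + K * 1 \<le> 2 * K" using K by simp
  moreover have "4 * R + K * ((3 + 1) * R) = (4 + 4 * K) * R" by (simp add: algebra_simps)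
  then have "4 * R + K * ((3 + 1) * R) \<le> 13 * K * R" using K by simp
  ultimately have "real (1 + K * 1) \<le> real (2 * K)" "real (4 * R + K * ((3 + 1) * R)) \<le> real (13 * K * R)"
    by (simp_all only: of_nat_le_iff)
  then have "T \<in> small_sumsets X Y (real (2 * K)) (real (13 * K * R))"
    using T(1) by (elim small_sumsets_mono[rotated -1]) (simp_all only: of_nat_add of_nat_1 subset_refl)
  moreover have "(+) a ` (Y \<inter> {b..<b + int R}) \<subseteq> T" using T(2) T1(2) by force
  ultimately show ?thesis using loss by blast
qed

lemma forward_window_cover:
  fixes X Y :: "int set" and a b S :: int and k l K :: nat
  assumes k: "0 < k" and l: "0 < l" and K: "0 < K"
    and S: "S = int (k * l)" and dense: "jointly_dense X Y (16 * S) a b"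
  shows "\<exists>T\<in>small_sumsets X Y (real (K * k)) (real (13 * K * l)).
     holes T (a + b + 4 * S) (a + b + 16 * S) \<le> 24 / 2 ^ K * pair_holes X Y a b S (16 * S)"
proof -
  let ?z = "a + b + 4 * S" and ?h = "pair_holes X Y a b S (16 * S)"
  have S_pos: "0 < S" using k l by (simp add: S)
  have "holes X (a + S) (a + S + S) + holes Y (?z - (a + S) - S + 1) (?z + int 12 * S - (a + S)) \<le> ?h"
    unfolding pair_holes_def by (rule add_mono; rule holes_mono) (use S_pos in auto)
  from window_cover[OF k l S subset_refl this, of K]
  obtain T where T: "T \<in> small_sumsets X Y (real (K * k)) (real (13 * K * l))"
    "holes T ?z (?z + 12 * S) \<le> (?h / of_int S) ^ K * (12 * of_int S)"
    using S_pos by (auto simp: holes_def mult_ac)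
  have "?h \<le> pair_holes X Y a b 0 (16 * S)" using S_pos by (intro pair_holes_mono) auto
  also have "32 * \<dots> \<le> of_int (16 * S)" using S_pos by (intro jointly_denseD(1)[OF dense]) auto
  finally have "?h \<le> of_int S / 2" by simp
  then have "(?h / of_int S) ^ K * of_int S \<le> 2 / 2 ^ K * ?h"
    using S_pos K by (intro ratio_power_mult_le) auto
  then have "holes T ?z (?z + 12 * S) \<le> 24 / 2 ^ K * ?h" using T(2) by simp
  then show ?thesis using T(1) by (auto simp: algebra_simps)
qed

text \<open>Each scale \<open>S = R 4\<^sup>j\<close> is charged to the holes at distance \<open>[S, 16S)\<close>, so a hole is charged at most twice.\<close>

lemma forward_cover:
  fixes X Y :: "int set" and L a b :: int and R K J :: nat
  assumes R: "0 < R" and K: "0 < K" and L: "L = int (R * 4 ^ J)" and dense: "jointly_dense X Y (4 * L) a b"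
  shows "\<exists>T\<in>small_sumsets X Y (real (2 * K * 2 ^ J)) (real (13 * K * (R * 2 ^ J))).
     (+) a ` (Y \<inter> {b..<b + int R}) \<subseteq> T \<and>
     holes T (a + b + int R) (a + b + 4 * L) \<le>
       24 / 2 ^ K * (pair_holes X Y a b (int R) (4 * L) + pair_holes X Y a b (int R) L)"
  using L dense
proof (induction J arbitrary: L)
  case 0
  then show ?case using first_window_cover[OF R K, of X Y a b] by (auto simp: pair_holes_def)
next
  case (Suc J)
  define S where "S = int (R * 4 ^ J)"
  let ?H = "pair_holes X Y a b"
  have "R \<le> R * 4 ^ J" by simp
  then have S: "L = 4 * S" "S = int (2 ^ J * (R * 2 ^ J))" "int R \<le> S"
    using Suc.prems(1) unfolding S_def
    by (simp_all only: of_nat_le_iff) (simp_all add: mult_ac flip: power_mult_distrib)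
  have S_pos: "0 < S" using R by (simp add: S_def)
  have "jointly_dense X Y (4 * S) a b" using Suc.prems(2) S S_pos by (auto elim: jointly_dense_antimono)
  from Suc.IH[OF S_def this] obtain T1 where
    T1: "T1 \<in> small_sumsets X Y (real (2 * K * 2 ^ J)) (real (13 * K * (R * 2 ^ J)))"
      "(+) a ` (Y \<inter> {b..<b + int R}) \<subseteq> T1"
      "holes T1 (a + b + int R) (a + b + 4 * S) \<le> 24 / 2 ^ K * (?H (int R) (4 * S) + ?H (int R) S)" by blast
  have "jointly_dense X Y (16 * S) a b" using Suc.prems(2) S(1) by simp
  from forward_window_cover[OF _ _ K S(2) this] R obtain T2 where
    T2: "T2 \<in> small_sumsets X Y (real (K * 2 ^ J)) (real (13 * K * (R * 2 ^ J)))"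
      "holes T2 (a + b + 4 * S) (a + b + 16 * S) \<le> 24 / 2 ^ K * ?H S (16 * S)"
    by (metis mult_pos_pos zero_less_numeral zero_less_power)
  from small_sumsets_Un[OF T1(1) T2(1)] obtain T where
    T: "T \<in> small_sumsets X Y (real (2 * K * 2 ^ J) + real (K * 2 ^ J))
          (real (13 * K * (R * 2 ^ J)) + real (13 * K * (R * 2 ^ J)))" "T1 \<subseteq> T" "T2 \<subseteq> T" by blast
  have "T \<in> small_sumsets X Y (real (2 * K * 2 ^ Suc J)) (real (13 * K * (R * 2 ^ Suc J)))"
    using T(1) by (elim small_sumsets_mono[rotated -1]) auto
  moreover have "(+) a ` (Y \<inter> {b..<b + int R}) \<subseteq> T" using T1(2) T(2) by blast
  moreover have "holes T (a + b + int R) (a + b + 4 * L) \<le> 24 / 2 ^ K * (?H (int R) (4 * L) + ?H (int R) L)"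
  proof -
    have "holes T (a + b + int R) (a + b + 16 * S)
        = holes T (a + b + int R) (a + b + 4 * S) + holes T (a + b + 4 * S) (a + b + 16 * S)"
      using S S_pos by (intro holes_split) auto
    also have "\<dots> \<le> holes T1 (a + b + int R) (a + b + 4 * S) + holes T2 (a + b + 4 * S) (a + b + 16 * S)"
      using T(2,3) by (intro add_mono holes_antimono)
    also have "\<dots> \<le> 24 / 2 ^ K * (?H (int R) (4 * S) + (?H (int R) S + ?H S (16 * S)))"
      using T1(3) T2(2) by (simp add: algebra_simps)
    also have "?H (int R) S + ?H S (16 * S) = ?H (int R) (16 * S)"
      using S S_pos by (intro pair_holes_split[symmetric]) auto
    finally show ?thesis by (simp add: S(1) add.commute)
  qed
  ultimately show ?case by blast
qed

section \<open>Gaining a surplus at the left end\<close>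

lemma mult_min_ge:
  fixes e C u k l v :: real
  assumes "0 \<le> e" "e \<le> 1" "0 \<le> C" "0 \<le> u" "1 \<le> l" "0 \<le> v" "v \<le> C * k * l" "e * v \<le> C * u"
  shows "e * v \<le> C * min u k * l"
proof (cases "u \<le> k")
  case True
  have "C * u * 1 \<le> C * u * l" using assms by (intro mult_left_mono) auto
  then show ?thesis using assms True by simp
next
  case False
  have "e * v \<le> 1 * v" using assms by (intro mult_right_mono)
  then show ?thesis using assms False by simp
qed

lemma balanced_sumset:
  fixes U V :: "'a::cancel_semigroup_add set" and e C :: real and k l :: nat
  assumes U: "finite U" and V: "finite V" and e: "0 < e" "e \<le> 1" and C: "0 \<le> C"
    and card_V: "real (card V) \<le> C * real k * real l" "e * real (card V) \<le> C * real (card U)"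
  shows "\<exists>S\<in>small_sumsets U V (real k) ((C / e\<^sup>2 + 1) * real l). (1 - e) * real (card V) \<le> real (card S)"
proof (cases "V = {}")
  case True
  then show ?thesis using C e by (intro bexI[of _ "{}"]) (auto simp: empty_mem_small_sumsets)
next
  case False
  then have "0 < card V" using V by (simp add: card_gt_0_iff)
  then have "0 < k" "0 < l" "0 < card U" using card_V e by (auto intro!: Nat.gr0I simp: mult_le_0_iff)
  define u where "u = min (card U) k"
  have u: "0 < u" using \<open>0 < k\<close> \<open>0 < card U\<close> by (simp add: u_def)
  obtain U' where U': "U' \<subseteq> U" "card U' = u" "finite U'"
    using obtain_subset_with_card_n[of u U] by (auto simp: u_def)
  have "e * real (card V) \<le> C * real u * real l"
    unfolding u_def of_nat_min using card_V e C \<open>0 < l\<close> by (intro mult_min_ge) auto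
  then have steps_le: "real (card V) / (e * real u) \<le> C / e\<^sup>2 * real l"
    using e u by (simp add: field_simps power2_eq_square)
  define M where "M = nat \<lceil>real (card V) / (e * real u)\<rceil>"
  have "0 < real (card V) / (e * real u)" using \<open>0 < card V\<close> e u by simp
  then have M: "real (card V) / (e * real u) \<le> real M" "real M \<le> real (card V) / (e * real u) + 1"
    unfolding M_def by linarith+
  from greedy_sumset[OF U'(3) V, of e M] e obtain V' where V': "V' \<subseteq> V" "card V' \<le> M"
    "min ((1 - e) * real (card V)) (real M * e * real u) \<le> real (card (U' + V'))"
    using U' by auto
  have "(1 - e) * real (card V) \<le> 1 * real (card V)" using e by (intro mult_right_mono) auto
  also have "\<dots> \<le> real M * e * real u" using M(1) e u by (simp add: field_simps)
  finally have "(1 - e) * real (card V) \<le> real (card (U' + V'))" using V'(3) by linarith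
  moreover have "real (card V') \<le> (C / e\<^sup>2 + 1) * real l"
    using V'(2) M(2) steps_le \<open>0 < l\<close> by (simp add: distrib_right)
  then have "U' + V' \<in> small_sumsets U V (real k) ((C / e\<^sup>2 + 1) * real l)"
    using U' V' finite_subset[OF V'(1) V] by (intro small_sumsetsI) (auto simp: u_def)
  ultimately show ?thesis by blast
qed

lemma balanced_sumsets_adjacent:
  fixes A B U V U' V' :: "int set" and \<epsilon> C :: real and k l :: nat
  assumes \<epsilon>: "0 < \<epsilon>" "\<epsilon> \<le> 1" "0 \<le> C" and uvw: "u \<le> v" "v \<le> w"
    and UV: "finite U" "finite V" "U \<subseteq> A" "V \<subseteq> B" "U + V \<subseteq> {u..<v}"
      "real (card V) \<le> C * real k * real l" "\<epsilon> * real (card V) \<le> C * real (card U)"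
    and UV': "finite U'" "finite V'" "U' \<subseteq> B" "V' \<subseteq> A" "U' + V' \<subseteq> {v..<w}"
      "real (card V') \<le> C * real l * real k" "\<epsilon> * real (card V') \<le> C * real (card U')"
  shows "\<exists>W\<in>small_sumsets A B ((C / \<epsilon>\<^sup>2 + 2) * real k) ((C / \<epsilon>\<^sup>2 + 2) * real l).
    holes W u w \<le> of_int (w - u) - (1 - \<epsilon>) * real (card V) - (1 - \<epsilon>) * real (card V')"
proof -
  obtain S where S: "S \<in> small_sumsets U V (real k) ((C / \<epsilon>\<^sup>2 + 1) * real l)"
    "(1 - \<epsilon>) * real (card V) \<le> real (card S)"
    using balanced_sumset[OF UV(1,2) \<epsilon> UV(6,7)] by blast
  obtain S' where S': "S' \<in> small_sumsets U' V' (real l) ((C / \<epsilon>\<^sup>2 + 1) * real k)"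
    "(1 - \<epsilon>) * real (card V') \<le> real (card S')"
    using balanced_sumset[OF UV'(1,2) \<epsilon> UV'(6,7)] by blast
  have "S \<in> small_sumsets A B (real k) ((C / \<epsilon>\<^sup>2 + 1) * real l)"
    by (rule small_sumsets_mono[OF UV(3,4) _ _ S(1)]) auto
  moreover have "S' \<in> small_sumsets A B ((C / \<epsilon>\<^sup>2 + 1) * real k) (real l)"
    unfolding small_sumsets_commute[of A] by (rule small_sumsets_mono[OF UV'(3,4) _ _ S'(1)]) auto
  ultimately obtain W where W: "W \<in> small_sumsets A B (real k + (C / \<epsilon>\<^sup>2 + 1) * real k)
      ((C / \<epsilon>\<^sup>2 + 1) * real l + real l)" "S \<subseteq> W" "S' \<subseteq> W"
    using small_sumsets_Un by blast
  have "holes W u w \<le> of_int (w - u) - real (card S) - real (card S')"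
    using W(2,3) uvw UV(5) UV'(5) small_sumsets_subset_plus[OF S(1)] small_sumsets_subset_plus[OF S'(1)]
    by (intro holes_adjacent_le[of _ _ v]) auto
  moreover have "W \<in> small_sumsets A B ((C / \<epsilon>\<^sup>2 + 2) * real k) ((C / \<epsilon>\<^sup>2 + 2) * real l)"
    using W(1) by (simp add: algebra_simps)
  ultimately show ?thesis using S(2) S'(2) by (intro bexI[of _ W]) auto
qed

text \<open>In terms of cardinalities and up to the holes behind \<open>a\<close> and \<open>b\<close>: \<open>S\<close> has at least \<open>\<epsilon> r\<close> more elements
  in \<open>[0, a + b + r)\<close> than the \<open>|A \<inter> [0, a)| + |B \<inter> [0, b)| + r\<close> that are needed. The cost \<open>2 / \<epsilon>\<^sup>2 + 2\<close> is that
  of two greedily chosen sumsets.\<close>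

definition has_surplus ::
    "real \<Rightarrow> int set \<Rightarrow> int set \<Rightarrow> nat \<Rightarrow> nat \<Rightarrow> int \<Rightarrow> int \<Rightarrow> int \<Rightarrow> bool" where
  "has_surplus \<epsilon> A B k l a b r \<longleftrightarrow>
     (\<exists>S\<in>small_sumsets A B ((2 / \<epsilon>\<^sup>2 + 2) * real k) ((2 / \<epsilon>\<^sup>2 + 2) * real l).
        holes S 0 (a + b + r) + \<epsilon> * of_int r \<le> holes A 0 (a + r) + holes B 0 (b + r))"

lemma has_surplus_commute: "has_surplus \<epsilon> A B k l a b r \<longleftrightarrow> has_surplus \<epsilon> B A l k b a r"
  unfolding has_surplus_def small_sumsets_commute[of A] by (simp add: add.commute)

text \<open>The sums are split at \<open>a + b + r - p\<close>: below it, the few elements of \<open>A\<close> up to \<open>a - p + e\<close> are added to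
  \<open>B \<inter> [0, b + r - e)\<close>; above it, the few elements of \<open>B\<close> behind \<open>b\<close> are added to \<open>A \<inter> [a + r - p, a + r - e)\<close>.\<close>

lemma two_sided_surplus:
  fixes A B :: "int set" and a b r p e :: int and \<epsilon> :: real and k l :: nat
  assumes \<epsilon>: "0 < \<epsilon>" "\<epsilon> \<le> 1 / 2" and e: "0 \<le> e" "of_int e \<le> 2 * \<epsilon> * of_int r"
    and ab: "0 \<le> a" "0 \<le> b" and p: "0 \<le> p" "p \<le> r" and r_le: "of_int r \<le> real k * real l"
    and front_B: "real (card (B \<inter> {0..<b})) \<le> of_int r"
    and many_A: "\<epsilon> * of_int r \<le> real (card (A \<inter> {0..<a - p + e + 1}))"
    and many_B: "\<epsilon> * of_int r \<le> real (card (B \<inter> {b..<b + e + 1}))"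
    and gain: "of_int a + 8 * \<epsilon> * of_int r \<le> of_int p + holes A 0 (a + r - p)"
  shows "has_surplus \<epsilon> A B k l a b r"
proof -
  define U where "U = A \<inter> {0..<a - p + e + 1}"
  define V where "V = B \<inter> {0..<b + r - e}"
  define U' where "U' = B \<inter> {b..<b + e + 1}"
  define V' where "V' = A \<inter> {a + r - p..<a + r - e}"
  have "2 * \<epsilon> * of_int r \<le> 1 * of_int r" using \<epsilon> p by (intro mult_right_mono) auto
  then have "e \<le> r" using e by linarith
  have "holes B 0 (b + r - e) \<le> holes B 0 (b + r)" using e by (intro holes_mono) auto
  then have V_ge: "of_int (b + r - e) - holes B 0 (b + r) \<le> real (card V)"
    using card_Int_interval_ge[of "b + r - e" 0 B] unfolding V_def by linarith
  have "holes A (a + r - p) (a + r - e) \<le> holes A (a + r - p) (a + r)" using e by (intro holes_mono) auto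
  then have V'_ge: "of_int (p - e) - holes A (a + r - p) (a + r) \<le> real (card V')"
    using card_Int_interval_ge[of "a + r - e" "a + r - p" A] by (simp add: V'_def)
  have "real (card (B \<inter> {0..<b + (r - e)})) \<le> real (card (B \<inter> {0..<b})) + of_int (r - e)"
    using \<open>e \<le> r\<close> by (intro card_Int_interval_add_le) simp
  then have V_le: "real (card V) \<le> 2 * of_int r" using front_B e by (simp add: V_def add_diff_eq)
  have "card V' \<le> card {a + r - p..<a + r - e}" unfolding V'_def by (intro card_mono) auto
  then have V'_le: "real (card V') \<le> of_int r" using p e by simp
  have \<epsilon>V: "\<epsilon> * real (card V) \<le> 2 * (\<epsilon> * of_int r)" "\<epsilon> * real (card V') \<le> \<epsilon> * of_int r"
    using mult_left_mono[OF V_le, of \<epsilon>] mult_left_mono[OF V'_le, of \<epsilon>] \<epsilon> by simp_all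
  have "\<exists>W\<in>small_sumsets A B ((2 / \<epsilon>\<^sup>2 + 2) * real k) ((2 / \<epsilon>\<^sup>2 + 2) * real l).
      holes W 0 (a + b + r) \<le> of_int (a + b + r - 0) - (1 - \<epsilon>) * real (card V) - (1 - \<epsilon>) * real (card V')"
  proof (rule balanced_sumsets_adjacent)
    show "U + V \<subseteq> {0..<a + b + r - p}" by (fastforce simp: U_def V_def set_plus_def)
    show "U' + V' \<subseteq> {a + b + r - p..<a + b + r}" by (fastforce simp: U'_def V'_def set_plus_def)
    show "\<epsilon> * real (card V) \<le> 2 * real (card U)" using \<epsilon>V many_A unfolding U_def by linarith
    show "\<epsilon> * real (card V') \<le> 2 * real (card U')" using \<epsilon>V many_B unfolding U'_def by linarith
    show "real (card V) \<le> 2 * real k * real l" "real (card V') \<le> 2 * real l * real k"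
      using V_le V'_le r_le by (simp_all add: mult_ac)
  qed (use \<epsilon> ab p in \<open>auto simp: U_def V_def U'_def V'_def\<close>)
  then obtain W where W: "W \<in> small_sumsets A B ((2 / \<epsilon>\<^sup>2 + 2) * real k) ((2 / \<epsilon>\<^sup>2 + 2) * real l)"
    "holes W 0 (a + b + r) \<le> of_int (a + b + r) - (1 - \<epsilon>) * real (card V) - (1 - \<epsilon>) * real (card V')"
    by auto
  moreover have "holes A 0 (a + r) = holes A 0 (a + r - p) + holes A (a + r - p) (a + r)"
    using p ab by (intro holes_split) auto
  ultimately have "holes W 0 (a + b + r) + \<epsilon> * of_int r \<le> holes A 0 (a + r) + holes B 0 (b + r)"
    using V_ge V'_ge \<epsilon>V e(2) gain by (simp add: left_diff_distrib)
  then show ?thesis using W(1) unfolding has_surplus_def by blast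
qed

definition front :: "int set \<Rightarrow> int set \<Rightarrow> int \<Rightarrow> int \<Rightarrow> nat" where
  "front A B a b = card (A \<inter> {0..<a}) + card (B \<inter> {0..<b})"

lemma front_commute: "front A B a b = front B A b a"
  by (simp add: front_def)

lemma twice_pred_ceiling_bounds:
  fixes x :: real and e :: int
  assumes "0 < x" "e = 2 * (\<lceil>x\<rceil> - 1)"
  shows "0 \<le> e" "of_int e < 2 * x" "of_int e / 2 < real n \<Longrightarrow> x \<le> real n"
proof -
  have e: "real_of_int e = 2 * of_int \<lceil>x\<rceil> - 2" by (simp add: assms(2))
  show "0 \<le> e" using assms by simp
  show "of_int e < 2 * x" using e by linarith
  show "x \<le> real n" if "of_int e / 2 < real n"
  proof -
    have "real_of_int (\<lceil>x\<rceil> - 1) < of_int (int n)" using that e by simp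
    then have "\<lceil>x\<rceil> \<le> int n" by (simp only: of_int_less_iff)
    then show ?thesis by (simp add: ceiling_le_iff)
  qed
qed

lemma no_surplus_imp_few_before:
  fixes A B :: "int set" and a b r e p :: int and \<epsilon> :: real
  assumes dense: "jointly_dense A B r a b" and ab: "0 \<le> a" "0 \<le> b"
    and front: "real (front A B a b) \<le> of_int r" and r: "1 \<le> r" "of_int r \<le> real k * real l"
    and \<epsilon>: "0 < \<epsilon>" "\<epsilon> \<le> 1 / 2" and e: "e = 2 * (\<lceil>\<epsilon> * of_int r\<rceil> - 1)"
    and no_surplus: "\<not> has_surplus \<epsilon> A B k l a b r"
    and p: "0 \<le> p" "p \<le> r" and gain: "of_int a + 8 * \<epsilon> * of_int r \<le> of_int p + holes A 0 (a + r - p)"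
  shows "of_int (a - p + e + 1) \<le> holes A 0 (a - p + e + 1) + of_int e / 2"
proof (rule ccontr)
  assume "\<not> ?thesis"
  then have many_A: "of_int e / 2 < real (card (A \<inter> {0..<a - p + e + 1}))"
    using card_Int_interval_ge[of "a - p + e + 1" 0 A] by simp
  have \<epsilon>r: "0 < \<epsilon> * of_int r" "2 * (\<epsilon> * of_int r) \<le> of_int r"
    using \<epsilon> r(1) mult_right_mono[of \<epsilon> "1 / 2" "of_int r"] by auto
  note e_bounds = twice_pred_ceiling_bounds(1,2)[OF \<epsilon>r(1) e]
    and rounding = twice_pred_ceiling_bounds(3)[OF \<epsilon>r(1) e]
  have "e + 1 \<le> r" using e_bounds(2) \<epsilon>r(2) by linarith
  have "32 * holes B b (b + (e + 1)) \<le> of_int (e + 1)"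
    using e_bounds \<open>e + 1 \<le> r\<close> by (intro jointly_denseD(3)[OF dense]) auto
  then have many_B: "of_int e / 2 < real (card (B \<inter> {b..<b + e + 1}))"
    using card_Int_interval_ge[of "b + (e + 1)" b B] e_bounds(1) by (simp add: add.assoc)
  have "has_surplus \<epsilon> A B k l a b r"
    using \<epsilon> e_bounds ab p r front gain rounding[OF many_A] rounding[OF many_B]
    by (intro two_sided_surplus[where p = p and e = e]) (auto simp: front_def)
  with no_surplus show False by simp
qed

text \<open>The threshold \<open>p\<close> is the least one with the gain required by \<open>two_sided_surplus\<close>.\<close>

lemma no_surplus_imp_threshold:
  fixes A B :: "int set" and a b r e :: int and \<epsilon> :: real
  assumes dense: "jointly_dense A B r a b" and ab: "0 \<le> a" "0 \<le> b"
    and front: "8 * real (front A B a b) \<le> of_int r" and r: "1 \<le> r" "of_int r \<le> real k * real l"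
    and \<epsilon>: "0 < \<epsilon>" "\<epsilon> \<le> 1 / 100" and e: "e = 2 * (\<lceil>\<epsilon> * of_int r\<rceil> - 1)"
    and no_surplus: "\<not> has_surplus \<epsilon> A B k l a b r"
  obtains p where "1 \<le> p" "p \<le> r" "of_int p + holes A 0 (a + r - p) < of_int a + 8 * \<epsilon> * of_int r + 1"
    "of_int (a - p + e + 1) \<le> holes A 0 (a - p + e + 1) + of_int e / 2"
proof -
  have \<epsilon>r: "0 < \<epsilon> * of_int r" "\<epsilon> * of_int r \<le> of_int r / 100"
    using \<epsilon> r mult_right_mono[of \<epsilon> "1 / 100" "of_int r"] by auto
  note e_bounds = twice_pred_ceiling_bounds(1,2)[OF \<epsilon>r(1) e]
  have "e + 1 \<le> r" using e_bounds(2) \<epsilon>r(2) r(1) by linarith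
  have card_front: "real (card (A \<inter> {0..<a})) = of_int a - holes A 0 a"
    using card_Int_interval[of 0 a A] ab by simp
  define gainful where "gainful =
    (\<lambda>n::nat. of_int a + 8 * \<epsilon> * of_int r \<le> real n + holes A 0 (a + r - int n))"
  define p where "p = (LEAST n. gainful n)"
  have "real (card (A \<inter> {0..<a})) + 8 * (\<epsilon> * of_int r) \<le> of_int r"
    using front \<epsilon>r(2) by (simp add: front_def)
  then have "gainful (nat r)" using card_front r by (simp add: gainful_def)
  then have gainful_p: "gainful p" and "p \<le> nat r"
    unfolding p_def by (rule LeastI, intro Least_le)
  then have p_le: "int p \<le> r" using r by simp
  have few_before: "of_int (a - int p + e + 1) \<le> holes A 0 (a - int p + e + 1) + of_int e / 2"
    using front \<epsilon> p_le gainful_p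
    by (intro no_surplus_imp_few_before[OF dense ab _ r _ _ e no_surplus]) (auto simp: gainful_def)
  have "p \<noteq> 0"
  proof
    assume "p = 0"
    moreover have "holes A 0 (a + (e + 1)) = holes A 0 a + holes A a (a + (e + 1))"
      using ab e_bounds by (intro holes_split) auto
    moreover have "32 * holes A a (a + (e + 1)) \<le> of_int (e + 1)"
      using e_bounds \<open>e + 1 \<le> r\<close> by (intro jointly_denseD(2)[OF dense]) auto
    ultimately show False using few_before card_front e_bounds by (simp add: add.assoc)
  qed
  have "\<not> gainful (p - 1)" using \<open>p \<noteq> 0\<close> not_less_Least[of "p - 1" gainful] by (simp add: p_def)
  moreover have "holes A 0 (a + r - int p) \<le> holes A 0 (a + r - int (p - 1))" by (intro holes_mono) auto
  ultimately have "of_int (int p) + holes A 0 (a + r - int p) < of_int a + 8 * \<epsilon> * of_int r + 1"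
    using \<open>p \<noteq> 0\<close> by (simp add: gainful_def of_nat_diff)
  then show thesis using \<open>p \<noteq> 0\<close> p_le few_before by (intro that[of "int p"]) auto
qed

lemma no_surplus_imp_full_beyond:
  fixes A B :: "int set" and a b s :: int and \<epsilon> :: real
  assumes dense: "jointly_dense A B (2 * s) a b" and ab: "0 \<le> a" "0 \<le> b"
    and front: "4 * real (front A B a b) \<le> of_int s" and s: "1 \<le> s" "of_int (2 * s) \<le> real k * real l"
    and \<epsilon>: "0 < \<epsilon>" "\<epsilon> \<le> 1 / 100" and no_surplus: "\<not> has_surplus \<epsilon> A B k l a b (2 * s)"
  shows "holes A a (a + s) \<le> 16 * \<epsilon> * of_int s"
proof -
  define e where "e = 2 * (\<lceil>\<epsilon> * of_int (2 * s)\<rceil> - 1)"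
  obtain p where p: "1 \<le> p" "p \<le> 2 * s"
      "of_int p + holes A 0 (a + 2 * s - p) < of_int a + 8 * \<epsilon> * of_int (2 * s) + 1"
      "of_int (a - p + e + 1) \<le> holes A 0 (a - p + e + 1) + of_int e / 2"
    using no_surplus_imp_threshold[OF dense ab _ _ s(2) \<epsilon> e_def no_surplus] front s(1) by auto
  have \<epsilon>s: "0 < \<epsilon> * of_int s" "\<epsilon> * of_int s \<le> of_int s / 100"
    using \<epsilon> s mult_right_mono[of \<epsilon> "1 / 100" "of_int s"] by auto
  then have e: "0 \<le> e" "of_int e < 4 * (\<epsilon> * of_int s)"
    using twice_pred_ceiling_bounds(1,2)[OF _ e_def] by (simp_all add: mult_ac)
  have card_front: "real (card (A \<inter> {0..<a})) = of_int a - holes A 0 a"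
    using card_Int_interval[of 0 a A] ab by simp
  have split: "holes A 0 (a + 2 * s - p) = holes A 0 a + holes A a (a + 2 * s - p)"
    using p(2) ab by (intro holes_split) auto
  have "of_int a + 1 - of_int p \<le> holes A 0 a"
  proof (cases "a - p + e + 1 \<le> a")
    case True
    then have "holes A 0 (a - p + e + 1) \<le> holes A 0 a" by (intro holes_mono) auto
    then show ?thesis using p(4) e(1) by simp
  next
    case False
    then have "holes A 0 (a - p + e + 1) = holes A 0 a + holes A a (a + (e + 1 - p))"
      using ab holes_split[of 0 a "a + (e + 1 - p)" A] by (simp add: algebra_simps)
    moreover have "32 * holes A a (a + (e + 1 - p)) \<le> of_int (e + 1 - p)"
      using False e \<epsilon>s p(1) by (intro jointly_denseD(2)[OF dense]) linarith+
    ultimately show ?thesis using p(1,4) e(1) by simp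
  qed
  then have full: "holes A a (a + 2 * s - p) \<le> 16 * \<epsilon> * of_int s" using p(3) split by simp
  have "real (card (A \<inter> {0..<a})) \<le> of_int s / 4" using front by (simp add: front_def)
  moreover have "of_int p + holes A 0 (a + 2 * s - p) < of_int a + 16 * (\<epsilon> * of_int s) + 1"
    using p(3) by simp
  moreover have "(1::real) \<le> of_int s" using s(1) by simp
  ultimately have "of_int p < of_int s + (1::real)"
    using split card_front holes_nonneg[of A a "a + 2 * s - p"] \<epsilon>s by linarith
  then have "holes A a (a + s) \<le> holes A a (a + 2 * s - p)" by (intro holes_mono) auto
  with full show ?thesis by linarith
qed

lemma no_surplus_imp_full_start:
  fixes A B :: "int set" and a b t :: int and \<epsilon> :: real
  assumes dense: "jointly_dense A B (16 * t) a b" and ab: "0 \<le> a" "0 \<le> b"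
    and t: "t = int (front A B a b)" "1 \<le> t" "of_int (16 * t) \<le> real k * real l"
    and AB: "card (B \<inter> {0..<b}) \<le> card (A \<inter> {0..<a})"
    and \<epsilon>: "0 < \<epsilon>" "\<epsilon> \<le> 1 / 100" and no_surplus: "\<not> has_surplus \<epsilon> A B k l a b (16 * t)"
  obtains a' where "0 \<le> a'" "a' \<le> a" "real (card (A \<inter> {0..<a'})) \<le> 16 * \<epsilon> * of_int t"
    "holes A a' a \<le> 128 * \<epsilon> * of_int t"
proof -
  define e where "e = 2 * (\<lceil>\<epsilon> * of_int (16 * t)\<rceil> - 1)"
  obtain p where p: "p \<le> 16 * t"
      "of_int p + holes A 0 (a + 16 * t - p) < of_int a + 8 * \<epsilon> * of_int (16 * t) + 1"
      "of_int (a - p + e + 1) \<le> holes A 0 (a - p + e + 1) + of_int e / 2"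
    using no_surplus_imp_threshold[OF dense ab _ _ t(3) \<epsilon> e_def no_surplus] t by auto
  have \<epsilon>t: "0 < \<epsilon> * of_int t" "\<epsilon> * of_int t \<le> of_int t / 100"
    using \<epsilon> t(2) mult_right_mono[of \<epsilon> "1 / 100" "of_int t"] by auto
  then have e: "0 \<le> e" "of_int e < 32 * (\<epsilon> * of_int t)"
    using twice_pred_ceiling_bounds(1,2)[OF _ e_def] by (simp_all add: mult_ac)
  define a' where "a' = max 0 (a - p + e + 1)"
  have card_a': "real (card (A \<inter> {0..<a'})) = of_int a' - holes A 0 a'"
    using card_Int_interval[of 0 a' A] by (simp add: a'_def)
  have sparse: "of_int a' - holes A 0 a' \<le> of_int e / 2" using p(3) e(1) by (simp add: a'_def max_def)
  have "a' \<le> a"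
  proof (rule ccontr)
    assume "\<not> a' \<le> a"
    then have "card (A \<inter> {0..<a}) \<le> card (A \<inter> {0..<a'})" by (intro card_mono) auto
    moreover have "real_of_int t \<le> 2 * real (card (A \<inter> {0..<a}))" using AB by (simp add: t(1) front_def)
    ultimately show False using card_a' sparse e(2) \<epsilon>t t(2) by linarith
  qed
  moreover have "holes A a' a \<le> 128 * \<epsilon> * of_int t"
  proof -
    have "holes A 0 a = holes A 0 a' + holes A a' a"
      using \<open>a' \<le> a\<close> by (intro holes_split) (auto simp: a'_def)
    moreover have "holes A 0 a \<le> holes A 0 (a + 16 * t - p)" using p(1) by (intro holes_mono) auto
    moreover have "of_int (a - p + e + 1) \<le> real_of_int a'" by (simp add: a'_def)
    ultimately show ?thesis using p(2) sparse e(1) by simp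
  qed
  moreover have "real (card (A \<inter> {0..<a'})) \<le> 16 * \<epsilon> * of_int t" using card_a' sparse e(2) by simp
  ultimately show thesis by (intro that[of a']) (auto simp: a'_def)
qed

lemma exists_jointly_dense_nearby:
  fixes A B :: "int set" and L a b t :: int
  assumes t: "1 \<le> t" "128 * t \<le> L"
    and middle_scales: "\<And>m. 4 * t \<le> m \<Longrightarrow> 4 * m \<le> L \<Longrightarrow> pair_holes A B a b 0 m \<le> of_int m / 10000"
    and large_scales: "pair_holes A B a b 0 (4 * L + t) \<le> of_int L / 10000"
  obtains i where "0 \<le> i" "10 * i \<le> t" "jointly_dense A B (4 * L) (a + i) (b + i)"
proof -
  define n where "n = t div 10 + 1"
  have n: "10 * n \<le> t + 10" "t < 10 * n" unfolding n_def by auto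
  have "pair_holes A B a b 0 (n + 4 * t) \<le> pair_holes A B a b 0 (6 * t)"
    using n t by (intro pair_holes_mono) auto
  also have "\<dots> \<le> of_int (6 * t) / 10000" using t by (intro middle_scales) auto
  finally have "32 * pair_holes A B a b 0 (n + 4 * t) < of_int n" using n(2) t(1) by simp
  then obtain i where i: "0 \<le> i" "i < n" and small: "jointly_dense A B (4 * t) (a + i) (b + i)"
    using exists_jointly_dense[of "4 * t" n A B a b] t n by auto
  have it: "10 * i \<le> t" using i n by linarith
  have "32 * pair_holes A B (a + i) (b + i) 0 s \<le> of_int s" if s: "0 \<le> s" "s \<le> 4 * L" for s
  proof -
    have holes_le: "pair_holes A B (a + i) (b + i) 0 s \<le> pair_holes A B a b 0 m" if "i + s \<le> m" for m
      using that i(1) by (intro pair_holes_mono) auto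
    consider (short) "s \<le> 4 * t" | (medium) "4 * t < s" "4 * (i + s) \<le> L" | (long) "L < 4 * (i + s)"
      by linarith
    then show ?thesis
    proof cases
      case short
      then show ?thesis using jointly_denseD(1)[OF small] s by simp
    next
      case medium
      then have "pair_holes A B (a + i) (b + i) 0 s \<le> of_int (i + s) / 10000"
        using holes_le[of "i + s"] middle_scales[of "i + s"] i by simp
      moreover have "real_of_int i \<le> of_int s" using medium it t by simp
      ultimately show ?thesis using s by simp
    next
      case long
      have "pair_holes A B (a + i) (b + i) 0 s \<le> of_int L / 10000"
        using holes_le[of "4 * L + t"] large_scales s it i t by simp
      moreover have "L < 8 * s" using long it t unfolding distrib_left by linarith
      then have "real_of_int L < 8 * of_int s" by linarith
      moreover have "(0::real) \<le> of_int s" using s by simp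
      ultimately show ?thesis by linarith
    qed
  qed
  then have "jointly_dense A B (4 * L) (a + i) (b + i)" by (simp add: jointly_dense_def)
  then show thesis using i it that by blast
qed

definition dense_start :: "int set \<Rightarrow> int set \<Rightarrow> int \<Rightarrow> int \<Rightarrow> int \<Rightarrow> bool" where
  "dense_start A B L a b \<longleftrightarrow>
     0 \<le> a \<and> 2 * a \<le> L \<and> 0 \<le> b \<and> 2 * b \<le> L \<and> jointly_dense A B (4 * L) a b"

lemma dense_start_commute: "dense_start A B L a b \<longleftrightarrow> dense_start B A L b a"
  using jointly_dense_commute[of A B] by (auto simp: dense_start_def)

lemma dense_startI:
  assumes dense: "jointly_dense A B (4 * L) a b" and ab: "0 \<le> a" "a \<le> 5 * L" "0 \<le> b" "b \<le> 5 * L"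
    and front: "128 * int (front A B a b) \<le> L"
    and holes_le: "pair_holes A B 0 0 0 (5 * L) \<le> of_int L / 10000"
  shows "dense_start A B L a b"
proof -
  have "real_of_int (128 * int (front A B a b)) \<le> of_int L" using front by (simp only: of_int_le_iff)
  then have "128 * real (card (A \<inter> {0..<a})) \<le> of_int L" "128 * real (card (B \<inter> {0..<b})) \<le> of_int L"
    by (simp_all add: front_def)
  moreover have "of_int a - holes A 0 a \<le> real (card (A \<inter> {0..<a}))"
    "of_int b - holes B 0 b \<le> real (card (B \<inter> {0..<b}))"
    using card_Int_interval_ge[of a 0 A] card_Int_interval_ge[of b 0 B] by simp_all
  moreover have "holes A 0 a \<le> holes A 0 (5 * L)" "holes B 0 b \<le> holes B 0 (5 * L)"
    using ab by (auto intro: holes_mono)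
  then have "holes A 0 a \<le> of_int L / 10000" "holes B 0 b \<le> of_int L / 10000"
    using holes_le holes_nonneg[of A 0 "5 * L"] holes_nonneg[of B 0 "5 * L"]
    unfolding pair_holes_def add_0 by linarith+
  ultimately have "2 * real_of_int a \<le> of_int L" "2 * real_of_int b \<le> of_int L"
    by linarith+
  then show ?thesis using dense ab by (simp add: dense_start_def)
qed

lemma front_add_le:
  assumes "0 \<le> i"
  shows "real (front A B (a + i) (b + i)) \<le> real (front A B a b) + 2 * of_int i"
  using card_Int_interval_add_le[OF assms, of A 0 a] card_Int_interval_add_le[OF assms, of B 0 b]
  by (simp add: front_def)

lemma no_surplus_imp_pair_holes_le:
  fixes A B :: "int set" and a b s :: int and \<epsilon> :: real
  assumes dense: "jointly_dense A B (2 * s) a b" and ab: "0 \<le> a" "0 \<le> b"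
    and front: "4 * real (front A B a b) \<le> of_int s" and s: "1 \<le> s" "of_int (2 * s) \<le> real k * real l"
    and \<epsilon>: "0 < \<epsilon>" "\<epsilon> \<le> 1 / 100" and no_surplus: "\<not> has_surplus \<epsilon> A B k l a b (2 * s)"
  shows "pair_holes A B a b 0 s \<le> 32 * \<epsilon> * of_int s"
proof -
  have "holes A a (a + s) \<le> 16 * \<epsilon> * of_int s"
    by (rule no_surplus_imp_full_beyond[OF dense ab front s \<epsilon> no_surplus])
  moreover have "holes B b (b + s) \<le> 16 * \<epsilon> * of_int s"
  proof (rule no_surplus_imp_full_beyond[where l = k])
    show "jointly_dense B A (2 * s) b a" using dense jointly_dense_commute by blast
    show "\<not> has_surplus \<epsilon> B A l k b a (2 * s)" using no_surplus has_surplus_commute by blast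
  qed (use ab front s \<epsilon> in \<open>simp_all add: front_commute[of B] mult.commute\<close>)
  ultimately show ?thesis by (simp add: pair_holes_def)
qed

lemma pair_holes_extend_left:
  assumes "a' \<le> a" "0 \<le> m"
  shows "pair_holes A B a' b 0 m \<le> holes A a' a + pair_holes A B a b 0 m"
  using assms holes_mono[of a' a' "a' + m" "a + m" A] holes_split[of a' a "a + m" A]
  by (simp add: pair_holes_def)

text \<open>Without a surplus, \<open>A\<close> is nearly full from a point \<open>a'\<close> close to its beginning up to \<open>a\<close>, and both sets
  are nearly full behind \<open>a\<close> and \<open>b\<close> at all scales beyond \<open>4t\<close>.\<close>

lemma dense_start_descent_left:
  fixes A B :: "int set" and L a b :: int
  assumes start: "dense_start A B L a b"
    and t: "t = int (front A B a b)" "1 \<le> t" "128 * t \<le> L" and L_le: "of_int L \<le> real k * real l"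
    and holes_le: "pair_holes A B 0 0 0 (5 * L) \<le> of_int L / 10000"
    and \<epsilon>: "0 < \<epsilon>" "\<epsilon> \<le> 1 / 1000000"
    and no_surplus: "\<And>r. 8 * t \<le> r \<Longrightarrow> 2 * r \<le> L \<Longrightarrow> \<not> has_surplus \<epsilon> A B k l a b r"
    and AB: "card (B \<inter> {0..<b}) \<le> card (A \<inter> {0..<a})"
  shows "\<exists>a' b'. dense_start A B L a' b' \<and> front A B a' b' < front A B a b"
proof -
  have ab: "0 \<le> a" "2 * a \<le> L" "0 \<le> b" "2 * b \<le> L" and dense: "jointly_dense A B (4 * L) a b"
    using start by (auto simp: dense_start_def)
  have \<epsilon>': "\<epsilon> \<le> 1 / 100" using \<epsilon> by simp
  have \<epsilon>_mult: "\<epsilon> * of_int m \<le> of_int m / 1000000" if "0 \<le> m" for m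
    using that \<epsilon> mult_right_mono[of \<epsilon> "1 / 1000000" "of_int m"] by simp
  have "jointly_dense A B (16 * t) a b" using dense by (rule jointly_dense_antimono) (use t in simp)
  moreover have "real_of_int (16 * t) \<le> of_int L" using t by (simp only: of_int_le_iff)
  then have "of_int (16 * t) \<le> real k * real l" using L_le by linarith
  moreover have "\<not> has_surplus \<epsilon> A B k l a b (16 * t)" using t by (intro no_surplus) auto
  ultimately obtain a' where a': "0 \<le> a'" "a' \<le> a"
      "real (card (A \<inter> {0..<a'})) \<le> 16 * \<epsilon> * of_int t" "holes A a' a \<le> 128 * \<epsilon> * of_int t"
    using no_surplus_imp_full_start[OF _ ab(1,3) t(1,2) _ AB \<epsilon>(1) \<epsilon>'] by blast
  have "pair_holes A B a' b 0 m \<le> of_int m / 10000" if m: "4 * t \<le> m" "4 * m \<le> L" for m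
  proof -
    have "jointly_dense A B (2 * m) a b" using dense by (rule jointly_dense_antimono) (use m t in simp)
    then have "pair_holes A B a b 0 m \<le> 32 * \<epsilon> * of_int m"
      using ab m t L_le \<epsilon> \<epsilon>' no_surplus[of "2 * m"]
      by (intro no_surplus_imp_pair_holes_le[where k = k and l = l]) auto
    then have "pair_holes A B a b 0 m \<le> 32 * (\<epsilon> * of_int m)" by simp
    moreover have "4 * real_of_int t \<le> of_int m" using m by linarith
    then have "4 * (\<epsilon> * of_int t) \<le> \<epsilon> * of_int m"
      using \<epsilon> mult_left_mono[of "4 * of_int t" "of_int m" \<epsilon>] by simp
    moreover have "holes A a' a \<le> 128 * (\<epsilon> * of_int t)" using a'(4) by simp
    moreover have "\<epsilon> * of_int m \<le> of_int m / 1000000" "(0::real) \<le> of_int m"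
      using m t \<epsilon>_mult[of m] by simp_all
    ultimately show ?thesis using pair_holes_extend_left[OF a'(2), of m A B b] m t by linarith
  qed
  moreover have "pair_holes A B a' b 0 (4 * L + t) \<le> pair_holes A B 0 0 0 (5 * L)"
    using a' ab t by (intro pair_holes_mono) auto
  then have "pair_holes A B a' b 0 (4 * L + t) \<le> of_int L / 10000" using holes_le by simp
  ultimately obtain i where i: "0 \<le> i" "10 * i \<le> t" and dense': "jointly_dense A B (4 * L) (a' + i) (b + i)"
    using exists_jointly_dense_nearby[of t L A B a' b] t by blast
  have "2 * real (card (B \<inter> {0..<b})) \<le> of_int t" using AB t(1) by (simp add: front_def)
  moreover have "10 * real_of_int i \<le> of_int t" "1 \<le> real_of_int t" using i t by linarith+
  moreover have "real (card (A \<inter> {0..<a'})) \<le> 16 * (\<epsilon> * of_int t)" using a'(3) by simp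
  moreover have "\<epsilon> * of_int t \<le> of_int t / 1000000" using t(2) by (intro \<epsilon>_mult) simp
  ultimately have "real (front A B (a' + i) (b + i)) < of_int t"
    using front_add_le[OF i(1), of A B a' b] unfolding front_def[of A B a' b] of_nat_add by linarith
  then have less: "front A B (a' + i) (b + i) < front A B a b" using t(1) by simp
  moreover have "dense_start A B L (a' + i) (b + i)"
    using a' ab i less t by (intro dense_startI[OF dense'] holes_le) auto
  ultimately show ?thesis by blast
qed

lemma dense_start_descent:
  fixes A B :: "int set" and L a b :: int
  assumes start: "dense_start A B L a b"
    and t: "t = int (front A B a b)" "1 \<le> t" "128 * t \<le> L" and L_le: "of_int L \<le> real k * real l"
    and holes_le: "pair_holes A B 0 0 0 (5 * L) \<le> of_int L / 10000"
    and \<epsilon>: "0 < \<epsilon>" "\<epsilon> \<le> 1 / 1000000"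
    and no_surplus: "\<And>r. 8 * t \<le> r \<Longrightarrow> 2 * r \<le> L \<Longrightarrow> \<not> has_surplus \<epsilon> A B k l a b r"
  shows "\<exists>a' b'. dense_start A B L a' b' \<and> front A B a' b' < front A B a b"
proof (cases "card (B \<inter> {0..<b}) \<le> card (A \<inter> {0..<a})")
  case True
  then show ?thesis using assms by (intro dense_start_descent_left)
next
  case False
  have "\<exists>b' a'. dense_start B A L b' a' \<and> front B A b' a' < front B A b a"
  proof (rule dense_start_descent_left)
    show "dense_start B A L b a" using start dense_start_commute by blast
    show "\<not> has_surplus \<epsilon> B A l k b a r" if "8 * t \<le> r" "2 * r \<le> L" for r
      using no_surplus[OF that] has_surplus_commute by blast
  qed (use False t L_le holes_le \<epsilon> in
        \<open>auto simp: front_commute[of B] pair_holes_commute[of B] mult.commute[of "real l"]\<close>)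
  then show ?thesis using dense_start_commute[of B A L] front_commute[of B A] by auto
qed

lemma dense_start_imp_surplus:
  fixes A B :: "int set" and L a b :: int
  assumes "dense_start A B L a b" "128 * int (front A B a b) \<le> L"
    and L_le: "of_int L \<le> real k * real l"
    and holes_le: "pair_holes A B 0 0 0 (5 * L) \<le> of_int L / 10000"
    and \<epsilon>: "0 < \<epsilon>" "\<epsilon> \<le> 1 / 1000000"
  shows "\<exists>a b r. dense_start A B L a b \<and> 0 \<le> r \<and> 2 * r \<le> L \<and> has_surplus \<epsilon> A B k l a b r"
  using assms(1,2)
proof (induction "front A B a b" arbitrary: a b rule: less_induct)
  case less
  define t where "t = int (front A B a b)"
  have ab: "0 \<le> a" "2 * a \<le> L" "0 \<le> b" using less.prems(1) by (auto simp: dense_start_def)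
  consider (empty_front) "t = 0" | (surplus) r where "8 * t \<le> r" "2 * r \<le> L" "has_surplus \<epsilon> A B k l a b r"
    | (no_surplus) "1 \<le> t" "\<And>r. 8 * t \<le> r \<Longrightarrow> 2 * r \<le> L \<Longrightarrow> \<not> has_surplus \<epsilon> A B k l a b r"
  proof -
    have "t = 0 \<or> 1 \<le> t" unfolding t_def by linarith
    then show ?thesis using that by blast
  qed
  then show ?case
  proof cases
    case empty_front
    then have "real (card (A \<inter> {0..<a})) = 0" "real (card (B \<inter> {0..<b})) = 0"
      unfolding t_def front_def by linarith+
    then have "of_int a = holes A 0 a" "of_int b = holes B 0 b"
      using ab card_Int_interval[of 0 a A] card_Int_interval[of 0 b B] by simp_all
    then have "has_surplus \<epsilon> A B k l a b 0"
      unfolding has_surplus_def using ab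
      by (intro bexI[of _ "{}"] empty_mem_small_sumsets) (simp_all add: holes_def)
    then show ?thesis using less.prems(1) ab by force
  next
    case surplus
    then show ?thesis using less.prems(1) by (intro exI[of _ a] exI[of _ b] exI[of _ r]) (auto simp: t_def)
  next
    case no_surplus
    then obtain a' b' where "dense_start A B L a' b'" "front A B a' b' < front A B a b"
      using dense_start_descent[OF less.prems(1) t_def _ _ L_le holes_le \<epsilon>] less.prems(2) t_def by blast
    then show ?thesis using less.hyps[of a' b'] less.prems(2) by simp
  qed
qed

lemma exists_dense_start_with_surplus:
  fixes A B :: "int set" and L :: int
  assumes L: "1 \<le> L" "of_int L \<le> real k * real l"
    and holes_le: "pair_holes A B 0 0 0 (5 * L) \<le> of_int L / 10000"
    and \<epsilon>: "0 < \<epsilon>" "\<epsilon> \<le> 1 / 1000000"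
  obtains a b r where "dense_start A B L a b" "0 \<le> r" "2 * r \<le> L" "has_surplus \<epsilon> A B k l a b r"
proof -
  define n where "n = L div 256 + 1"
  have n: "256 * n \<le> L + 256" "L < 256 * n" "1 \<le> n" using L unfolding n_def by auto
  have "pair_holes A B 0 0 0 (n + 4 * L) \<le> pair_holes A B 0 0 0 (5 * L)"
    using n L by (intro pair_holes_mono) auto
  then have "32 * pair_holes A B 0 0 0 (n + 4 * L) < of_int n" using holes_le n by linarith
  then obtain i where i: "0 \<le> i" "i < n" "jointly_dense A B (4 * L) i i"
    using exists_jointly_dense[of "4 * L" n A B 0 0] L n by auto
  have "int (card (C \<inter> {0..<i})) \<le> i" for C using card_mono[of "{0..<i}" "C \<inter> {0..<i}"] i(1) by simp
  from this[of A] this[of B] have "int (front A B i i) \<le> 2 * i" by (simp add: front_def)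
  then have front_le: "128 * int (front A B i i) \<le> L" using i n by linarith
  have "dense_start A B L i i" using i n L front_le by (intro dense_startI holes_le) auto
  then show thesis using dense_start_imp_surplus[OF _ front_le L(2) holes_le \<epsilon>] that by blast
qed

section \<open>Covering the ends\<close>

lemma forward_cover_from:
  fixes X Y :: "int set" and L a b :: int and R J :: nat
  assumes R: "0 < R" and L: "L = int (R * 4 ^ J)" and dense: "jointly_dense X Y (4 * L) a b"
  shows "\<exists>T\<in>small_sumsets X Y (real (42 * 2 ^ J)) (real (273 * (R * 2 ^ J))). \<forall>r\<ge>0.
     holes T (a + b + r) (a + b + 4 * L) \<le>
       holes Y (b + r) (b + int R) + 32 / 1000000 * pair_holes X Y a b (int R) (4 * L)"
proof -
  let ?H = "pair_holes X Y a b (int R)"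
  have "R \<le> R * 4 ^ J" by simp
  then have R_le: "int R \<le> L" unfolding L by (simp only: of_nat_le_iff)
  obtain T where T: "T \<in> small_sumsets X Y (real (2 * 21 * 2 ^ J)) (real (13 * 21 * (R * 2 ^ J)))"
      "(+) a ` (Y \<inter> {b..<b + int R}) \<subseteq> T"
      "holes T (a + b + int R) (a + b + 4 * L) \<le> 24 / 2 ^ 21 * (?H (4 * L) + ?H L)"
    using forward_cover[OF R _ L dense, of 21] by auto
  have "?H L \<le> ?H (4 * L)" using R_le by (intro pair_holes_mono) auto
  then have "24 / 2 ^ 21 * (?H (4 * L) + ?H L) \<le> 16 / 1000000 * (2 * ?H (4 * L))"
    by (intro mult_mono) (auto simp: add_nonneg_nonneg)
  then have beyond_R: "holes T (a + b + int R) (a + b + 4 * L) \<le> 32 / 1000000 * ?H (4 * L)"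
    using T(3) by linarith
  have "holes T (a + b + r) (a + b + 4 * L) \<le> holes Y (b + r) (b + int R) + 32 / 1000000 * ?H (4 * L)"
    if r: "0 \<le> r" for r
  proof (cases "r \<le> int R")
    case True
    have "(+) a ` (Y \<inter> {b + r..<b + int R}) \<subseteq> T" using T(2) r by auto
    then have "holes T (a + b + r) (a + b + int R) \<le> holes Y (b + r) (b + int R)"
      using holes_translate_le[of a Y "b + r" "b + int R" T] by (simp add: add.assoc)
    moreover have "holes T (a + b + r) (a + b + 4 * L)
        = holes T (a + b + r) (a + b + int R) + holes T (a + b + int R) (a + b + 4 * L)"
      using True R_le by (intro holes_split) auto
    ultimately show ?thesis using beyond_R by linarith
  next
    case False
    then have "holes T (a + b + r) (a + b + 4 * L) \<le> holes T (a + b + int R) (a + b + 4 * L)"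
      by (intro holes_mono) auto
    then show ?thesis using beyond_R holes_nonneg[of Y "b + r" "b + int R"] by linarith
  qed
  then show ?thesis using T(1) by auto
qed

lemma holes_weighted_tail_mono:
  fixes \<delta> :: real
  assumes "0 \<le> u" "u \<le> v" "v \<le> w" "w' \<le> w" "0 \<le> \<delta>" "\<delta> \<le> 1"
  shows "holes A 0 u + \<delta> * holes A u w' \<le> holes A 0 v + \<delta> * holes A v w"
proof -
  have "\<delta> * holes A u w' \<le> \<delta> * (holes A u v + holes A v w)"
    using assms holes_mono[of u u w' w A] holes_split[of u v w A] by (intro mult_left_mono) auto
  also have "\<dots> \<le> holes A u v + \<delta> * holes A v w"
    using assms mult_right_mono[of \<delta> 1 "holes A u v"] by (simp add: distrib_left)
  finally show ?thesis using assms holes_split[of 0 u v A] by simp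
qed

lemma surplus_pays_forward_loss:
  fixes A B :: "int set" and a b r R M :: int and \<epsilon> :: real
  assumes dense: "jointly_dense A B M a b" and ab: "0 \<le> a" "0 \<le> b" and r: "0 \<le> r" "r \<le> M"
    and \<epsilon>: "0 \<le> \<epsilon>" and R: "0 \<le> R"
  shows "holes A 0 (a + r) + holes B 0 (b + r) + holes B (b + r) (b + R)
      + 32 * \<epsilon> * pair_holes A B a b R M - \<epsilon> * of_int r
    \<le> holes A 0 (a + max r R) + holes B 0 (b + max r R) + 32 * \<epsilon> * pair_holes A B a b (max r R) M"
proof (cases "r \<le> R")
  case True
  then have "holes A 0 (a + r) \<le> holes A 0 (a + R)" by (intro holes_mono) auto
  moreover have "holes B 0 (b + R) = holes B 0 (b + r) + holes B (b + r) (b + R)"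
    using True ab r by (intro holes_split) auto
  moreover have "0 \<le> \<epsilon> * of_int r" using r \<epsilon> by simp
  ultimately show ?thesis using True by (simp add: max_def)
next
  case False
  have "pair_holes A B a b R M = pair_holes A B a b R r + pair_holes A B a b r M"
    using False r by (intro pair_holes_split) auto
  moreover have "pair_holes A B a b R r \<le> pair_holes A B a b 0 r" using R by (intro pair_holes_mono) auto
  then have "32 * pair_holes A B a b R r \<le> of_int r" using jointly_denseD(1)[OF dense r] by linarith
  then have "\<epsilon> * (32 * pair_holes A B a b R r) \<le> \<epsilon> * of_int r" using \<epsilon> by (rule mult_left_mono)
  ultimately show ?thesis using False by (simp add: algebra_simps max_def)
qed

lemma surplus_forward_cover:
  fixes X Y :: "int set" and L a b r :: int and R J :: nat
  assumes R: "0 < R" and L: "L = int (R * 4 ^ J)" and dense: "jointly_dense X Y (4 * L) a b"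
    and ab: "0 \<le> a" "0 \<le> b" and r: "0 \<le> r" "r \<le> 4 * L"
    and \<epsilon>: "\<epsilon> = 1 / 1000000" and surplus: "has_surplus \<epsilon> X Y (2 ^ J) (R * 2 ^ J) a b r"
  shows "\<exists>W\<in>small_sumsets X Y (3 * 10 ^ 12 * 2 ^ J) (3 * 10 ^ 12 * (real R * 2 ^ J)).
     holes W 0 (a + b + 4 * L) \<le> holes X 0 (a + max r (int R)) + holes Y 0 (b + max r (int R))
       + 32 * \<epsilon> * pair_holes X Y a b (max r (int R)) (4 * L)"
proof -
  obtain S where S: "S \<in> small_sumsets X Y ((2 / \<epsilon>\<^sup>2 + 2) * real (2 ^ J))
        ((2 / \<epsilon>\<^sup>2 + 2) * real (R * 2 ^ J))"
      "holes S 0 (a + b + r) + \<epsilon> * of_int r \<le> holes X 0 (a + r) + holes Y 0 (b + r)"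
    using surplus unfolding has_surplus_def by blast
  obtain T where T: "T \<in> small_sumsets X Y (real (42 * 2 ^ J)) (real (273 * (R * 2 ^ J)))"
      "holes T (a + b + r) (a + b + 4 * L)
        \<le> holes Y (b + r) (b + int R) + 32 * \<epsilon> * pair_holes X Y a b (int R) (4 * L)"
    using forward_cover_from[OF R L dense] r(1) by (auto simp: \<epsilon>)
  obtain W where W: "W \<in> small_sumsets X Y ((2 / \<epsilon>\<^sup>2 + 2) * real (2 ^ J) + real (42 * 2 ^ J))
      ((2 / \<epsilon>\<^sup>2 + 2) * real (R * 2 ^ J) + real (273 * (R * 2 ^ J)))" "S \<subseteq> W" "T \<subseteq> W"
    using small_sumsets_Un[OF S(1) T(1)] by blast
  have "holes W 0 (a + b + 4 * L) = holes W 0 (a + b + r) + holes W (a + b + r) (a + b + 4 * L)"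
    using ab r by (intro holes_split) auto
  also have "\<dots> \<le> holes S 0 (a + b + r) + holes T (a + b + r) (a + b + 4 * L)"
    using W(2,3) by (intro add_mono holes_antimono)
  also have "\<dots> \<le> holes X 0 (a + r) + holes Y 0 (b + r) + holes Y (b + r) (b + int R)
      + 32 * \<epsilon> * pair_holes X Y a b (int R) (4 * L) - \<epsilon> * of_int r" using S(2) T(2) by simp
  also have "\<dots> \<le> holes X 0 (a + max r (int R)) + holes Y 0 (b + max r (int R))
      + 32 * \<epsilon> * pair_holes X Y a b (max r (int R)) (4 * L)"
    using ab r by (intro surplus_pays_forward_loss[OF dense]) (auto simp: \<epsilon>)
  finally have "holes W 0 (a + b + 4 * L) \<le> \<dots>" .
  moreover have "W \<in> small_sumsets X Y (3 * 10 ^ 12 * 2 ^ J) (3 * 10 ^ 12 * (real R * 2 ^ J))"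
    by (rule small_sumsets_mono[OF _ _ _ _ W(1)]) (simp_all add: \<epsilon> power2_eq_square)
  ultimately show ?thesis by blast
qed

lemma end_cover:
  fixes X Y :: "int set" and L :: int and R J :: nat
  assumes R: "0 < R" and J: "0 < J" and L: "L = int (R * 4 ^ J)"
    and holes_le: "pair_holes X Y 0 0 0 (5 * L) \<le> of_int L / 10000"
  shows "\<exists>S\<in>small_sumsets X Y (3 * 10 ^ 12 * 2 ^ J) (3 * 10 ^ 12 * (real R * 2 ^ J)).
     holes S 0 (4 * L) \<le> pair_holes X Y 0 0 0 L + pair_holes X Y 0 0 L (5 * L) / 10"
proof -
  define \<epsilon> :: real where "\<epsilon> = 1 / 1000000"
  have \<epsilon>: "0 < \<epsilon>" "\<epsilon> \<le> 1 / 1000000" by (simp_all add: \<epsilon>_def)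
  have "R * 4 ^ 1 \<le> R * 4 ^ J" using J by (intro mult_left_mono power_increasing) auto
  then have "int (R * 4 ^ 1) \<le> L" unfolding L by (simp only: of_nat_le_iff)
  then have RL: "4 * int R \<le> L" by simp
  then have L_ge: "1 \<le> L" using R by linarith
  have "L = int (2 ^ J * (R * 2 ^ J))" by (simp add: L mult_ac flip: power_mult_distrib)
  then have "of_int L \<le> real (2 ^ J) * real (R * 2 ^ J)" by simp
  from exists_dense_start_with_surplus[OF L_ge this holes_le \<epsilon>]
  obtain a b r where start: "dense_start X Y L a b" and r: "0 \<le> r" "2 * r \<le> L"
    and surplus: "has_surplus \<epsilon> X Y (2 ^ J) (R * 2 ^ J) a b r" .
  have ab: "0 \<le> a" "2 * a \<le> L" "0 \<le> b" "2 * b \<le> L" and dense: "jointly_dense X Y (4 * L) a b"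
    using start by (auto simp: dense_start_def)
  define s where "s = max r (int R)"
  have s: "0 \<le> s" "2 * s \<le> L" using r RL by (auto simp: s_def)
  have "r \<le> 4 * L" using r L_ge by linarith
  then obtain W where W: "W \<in> small_sumsets X Y (3 * 10 ^ 12 * 2 ^ J) (3 * 10 ^ 12 * (real R * 2 ^ J))"
    "holes W 0 (a + b + 4 * L) \<le> holes X 0 (a + s) + holes Y 0 (b + s) + 32 * \<epsilon> * pair_holes X Y a b s (4 * L)"
    using surplus_forward_cover[OF R L dense ab(1,3) r(1) _ \<epsilon>_def surplus] unfolding s_def by blast
  have "holes W 0 (4 * L) \<le> holes W 0 (a + b + 4 * L)" using ab by (intro holes_mono) auto
  also have "\<dots> \<le> (holes X 0 (a + s) + 1 / 10 * holes X (a + s) (a + 4 * L))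
      + (holes Y 0 (b + s) + 1 / 10 * holes Y (b + s) (b + 4 * L))"
    using W(2) holes_nonneg[of X "a + s" "a + 4 * L"] holes_nonneg[of Y "b + s" "b + 4 * L"]
    unfolding pair_holes_def \<epsilon>_def distrib_left by linarith
  also have "\<dots> \<le> (holes X 0 L + 1 / 10 * holes X L (5 * L)) + (holes Y 0 L + 1 / 10 * holes Y L (5 * L))"
    using ab s r by (intro add_mono holes_weighted_tail_mono) linarith+
  finally have "holes W 0 (4 * L) \<le> pair_holes X Y 0 0 0 L + pair_holes X Y 0 0 L (5 * L) / 10"
    by (simp add: pair_holes_def add_divide_distrib)
  then show ?thesis using W(1) by blast
qed

lemma right_end_cover:
  fixes X Y :: "int set" and L m n :: int and R J :: nat
  assumes R: "0 < R" and J: "0 < J" and L: "L = int (R * 4 ^ J)"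
    and holes_le: "pair_holes X Y m n (- 5 * L) 0 \<le> of_int L / 10000"
  shows "\<exists>S\<in>small_sumsets X Y (3 * 10 ^ 12 * 2 ^ J) (3 * 10 ^ 12 * (real R * 2 ^ J)).
     holes S (m + n - 1 - 4 * L) (m + n - 1)
       \<le> pair_holes X Y m n (- L) 0 + pair_holes X Y m n (- 5 * L) (- L) / 10"
proof -
  have reflect: "pair_holes ((-) (m - 1) ` X) ((-) (n - 1) ` Y) 0 0 s t
      = pair_holes X Y m n (- t) (- s)" for s t
    by (simp add: pair_holes_def holes_reflect)
  have "pair_holes ((-) (m - 1) ` X) ((-) (n - 1) ` Y) 0 0 0 (5 * L) \<le> of_int L / 10000"
    using holes_le by (simp add: reflect)
  from end_cover[OF R J L this] obtain S where
    S: "S \<in> small_sumsets ((-) (m - 1) ` X) ((-) (n - 1) ` Y) (3 * 10 ^ 12 * 2 ^ J)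
          (3 * 10 ^ 12 * (real R * 2 ^ J))"
      "holes S 0 (4 * L) \<le> pair_holes X Y m n (- L) 0 + pair_holes X Y m n (- 5 * L) (- L) / 10"
    unfolding reflect by auto
  have "holes ((-) ((m - 1) + (n - 1)) ` S) (m + n - 1 - 4 * L) (m + n - 1) = holes S 0 (4 * L)"
    using holes_reflect[of "m + n - 1" S] by (simp add: algebra_simps)
  then show ?thesis using S(2) by (intro bexI[OF _ reflect_mem_small_sumsets[OF S(1)]]) simp
qed

section \<open>Covering the whole range\<close>

lemma middle_window_cover:
  fixes X Y :: "int set" and L m n z :: int and k l K :: nat
  assumes k: "0 < k" and l: "0 < l" and L: "L = int (k * l)" and mn: "4 * L \<le> m" "4 * L \<le> n"
    and z: "4 * L \<le> z" "z \<le> m + n - 4 * L" and h: "h = holes X L (m - L) + holes Y L (n - L)"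
  shows "\<exists>S\<in>small_sumsets X Y (real (K * k)) (real (2 * K * l)).
     holes S z (z + L) \<le> (h / of_int L) ^ K * of_int L"
proof -
  have "0 < L" using k l by (simp add: L)
  define w where "w = min (m - 2 * L) (z - 2 * L)"
  have "holes X w (w + L) + holes Y (z - w - L + 1) (z + int 1 * L - w) \<le> h"
    unfolding h by (rule add_mono; rule holes_mono) (use z mn \<open>0 < L\<close> in \<open>auto simp: w_def\<close>)
  from window_cover[OF k l L subset_refl this, of K] show ?thesis
    using \<open>0 < L\<close> by (simp add: holes_def mult_ac)
qed

lemma middle_cover:
  fixes X Y :: "int set" and L m n :: int and k l K t :: nat
  assumes k: "0 < k" and l: "0 < l" and L: "L = int (k * l)" and mn: "4 * L \<le> m" "4 * L \<le> n"
    and t: "4 * L + int t * L \<le> m + n - 3 * L" and h: "h = holes X L (m - L) + holes Y L (n - L)"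
  shows "\<exists>S\<in>small_sumsets X Y (real (t * (K * k))) (real (t * (2 * K * l))).
     holes S (4 * L) (4 * L + int t * L) \<le> real t * ((h / of_int L) ^ K * of_int L)"
  using t
proof (induction t)
  case 0
  show ?case by (rule bexI[of _ "{}"]) (simp_all add: empty_mem_small_sumsets)
next
  case (Suc t)
  have L_nonneg: "0 \<le> L" by (simp add: L)
  define z where "z = 4 * L + int t * L"
  have next_z: "4 * L + int (Suc t) * L = z + L" by (simp add: z_def algebra_simps)
  have z: "4 * L \<le> z" "z \<le> m + n - 4 * L" using Suc.prems L_nonneg unfolding next_z by (auto simp: z_def)
  then obtain S where S: "S \<in> small_sumsets X Y (real (t * (K * k))) (real (t * (2 * K * l)))"
      "holes S (4 * L) z \<le> real t * ((h / of_int L) ^ K * of_int L)"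
    using Suc.IH L_nonneg by (auto simp: z_def)
  obtain T where T: "T \<in> small_sumsets X Y (real (K * k)) (real (2 * K * l))"
      "holes T z (z + L) \<le> (h / of_int L) ^ K * of_int L"
    using middle_window_cover[OF k l L mn z h] by blast
  obtain W where W: "W \<in> small_sumsets X Y (real (t * (K * k)) + real (K * k))
      (real (t * (2 * K * l)) + real (2 * K * l))" "S \<subseteq> W" "T \<subseteq> W"
    using small_sumsets_Un[OF S(1) T(1)] by blast
  have "holes W (4 * L) (z + L) = holes W (4 * L) z + holes W z (z + L)"
    using z L_nonneg by (intro holes_split) auto
  also have "\<dots> \<le> holes S (4 * L) z + holes T z (z + L)" using W(2,3) by (intro add_mono holes_antimono)
  also have "\<dots> \<le> real (Suc t) * ((h / of_int L) ^ K * of_int L)"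
    using S(2) T(2) by (simp add: distrib_right)
  finally have "holes W (4 * L) (4 * L + int (Suc t) * L) \<le> real (Suc t) * ((h / of_int L) ^ K * of_int L)"
    unfolding next_z .
  moreover have "W \<in> small_sumsets X Y (real (Suc t * (K * k))) (real (Suc t * (2 * K * l)))"
    using W(1) by (simp add: algebra_simps)
  ultimately show ?case by blast
qed

definition middle_rounds :: "real \<Rightarrow> nat" where
  "middle_rounds Q = nat \<lceil>log 2 (40 * Q)\<rceil>"

lemma middle_rounds_bounds:
  assumes "1 \<le> Q"
  shows "0 < middle_rounds Q" "40 * Q \<le> 2 ^ middle_rounds Q"
proof -
  have "log 2 (40 * Q) \<le> real (middle_rounds Q)" unfolding middle_rounds_def by (rule real_nat_ceiling_ge)
  then show "40 * Q \<le> 2 ^ middle_rounds Q" using assms by (simp add: log_le_iff powr_realpow)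
  then show "0 < middle_rounds Q" using assms by (cases "middle_rounds Q") auto
qed

definition summand_cost :: "real \<Rightarrow> real" where
  "summand_cost Q = 6 * 10 ^ 12 + 4 * Q * real (middle_rounds Q)"

lemma middle_range_cover:
  fixes X Y :: "int set" and L m n :: int and k l :: nat
  assumes Q: "1 \<le> Q" and k: "0 < k" and l: "0 < l" and L: "L = int (k * l)"
    and m: "10 * L \<le> m" "of_int m \<le> Q * of_int L" and n: "10 * L \<le> n" "of_int n \<le> Q * of_int L"
    and h: "h = holes X L (m - L) + holes Y L (n - L)" "h \<le> of_int L / 2"
  shows "\<exists>S\<in>small_sumsets X Y (2 * Q * real (middle_rounds Q) * real k)
        (4 * Q * real (middle_rounds Q) * real l).
     holes S (4 * L) (m + n - 1 - 4 * L) \<le> h / 10"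
proof -
  have L_pos: "0 < L" using k l by (simp add: L)
  define K where "K = middle_rounds Q"
  define q where "q = (m + n) div L"
  have "q * L + (m + n) mod L = m + n" unfolding q_def by simp
  moreover have "0 \<le> (m + n) mod L" "(m + n) mod L < L" using L_pos by simp_all
  ultimately have q: "q * L \<le> m + n" "m + n < q * L + L" by linarith+
  have "7 * L < q * L + 1 * L" using q m n L_pos by linarith
  then have "7 * L < (q + 1) * L" by (simp only: distrib_right)
  then have "7 \<le> q" using L_pos by simp
  define t where "t = nat (q - 7)"
  have t: "4 * L + int t * L = q * L - 3 * L" using \<open>7 \<le> q\<close> by (simp add: t_def algebra_simps)
  have "of_int (q * L) \<le> 2 * Q * of_int L" using q(1) m(2) n(2) by linarith
  then have "of_int q \<le> 2 * Q" using L_pos by simp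
  then have tQ: "real t \<le> 2 * Q" using \<open>7 \<le> q\<close> by (simp add: t_def)
  have h_nonneg: "0 \<le> h" by (simp add: h(1))
  obtain S where S: "S \<in> small_sumsets X Y (real (t * (K * k))) (real (t * (2 * K * l)))"
      "holes S (4 * L) (4 * L + int t * L) \<le> real t * ((h / of_int L) ^ K * of_int L)"
    using middle_cover[OF k l L _ _ _ h(1), of t K] m n t q L_pos by auto
  have "holes S (4 * L) (m + n - 1 - 4 * L) \<le> holes S (4 * L) (4 * L + int t * L)"
    using t q by (intro holes_mono) auto
  also have "\<dots> \<le> real t * ((h / of_int L) ^ K * of_int L)" by (rule S(2))
  also have "\<dots> \<le> 2 * Q * (2 / 2 ^ K * h)"
  proof (rule mult_mono[OF tQ])
    show "(h / of_int L) ^ K * of_int L \<le> 2 / 2 ^ K * h"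
      unfolding K_def using L_pos by (intro ratio_power_mult_le h_nonneg h(2) middle_rounds_bounds(1) Q) simp
  qed (use h_nonneg Q L_pos in auto)
  also have "\<dots> = 4 * Q / 2 ^ K * h" by simp
  also have "\<dots> \<le> 1 / 10 * h"
    using middle_rounds_bounds(2)[OF Q] h_nonneg unfolding K_def
    by (intro mult_right_mono) (auto simp: field_simps)
  finally have "holes S (4 * L) (m + n - 1 - 4 * L) \<le> h / 10" by simp
  moreover have "real t * (real K * real k) \<le> 2 * Q * (real K * real k)"
    "real t * (2 * real K * real l) \<le> 2 * Q * (2 * real K * real l)"
    using tQ by (intro mult_right_mono; simp)+
  then have "S \<in> small_sumsets X Y (2 * Q * real K * real k) (4 * Q * real K * real l)"
    by (intro small_sumsets_mono[OF _ _ _ _ S(1)]) (simp_all add: mult_ac)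
  ultimately show ?thesis unfolding K_def by blast
qed

lemma holes_ends_and_middle_le:
  assumes "0 \<le> L" "10 * L \<le> m"
  shows "holes A 0 L + holes A L (5 * L) / 10 + holes A L (m - L) / 10
      + (holes A (m - L) m + holes A (m - 5 * L) (m - L) / 10) \<le> holes A 0 m"
proof -
  have "holes A 0 m = holes A 0 L + (holes A L (m - L) + holes A (m - L) m)"
    using assms holes_split[of 0 L m A] holes_split[of L "m - L" m A] by auto
  moreover have "holes A L (5 * L) \<le> holes A L (m - L)" "holes A (m - 5 * L) (m - L) \<le> holes A L (m - L)"
    using assms by (auto intro!: holes_mono)
  ultimately show ?thesis using holes_nonneg[of A L "m - L"] by linarith
qed

lemma nearly_full_cover:
  fixes X Y :: "int set" and L m n :: int and R J :: nat
  assumes Q: "1 \<le> Q" and R: "0 < R" and J: "0 < J" and L: "L = int (R * 4 ^ J)"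
    and m: "10 * L \<le> m" "of_int m \<le> Q * of_int L" and n: "10 * L \<le> n" "of_int n \<le> Q * of_int L"
    and holes_le: "holes X 0 m + holes Y 0 n \<le> of_int L / 10000"
  shows "\<exists>S\<in>small_sumsets X Y (summand_cost Q * 2 ^ J) (summand_cost Q * (real R * 2 ^ J)).
     holes S 0 (m + n - 1) \<le> holes X 0 m + holes Y 0 n"
proof -
  have L_pos: "0 < L" using R by (simp add: L)
  have L_eq: "L = int (2 ^ J * (R * 2 ^ J))" by (simp add: L mult_ac flip: power_mult_distrib)
  define h where "h = holes X L (m - L) + holes Y L (n - L)"
  let ?M = "m + n - 1 - 4 * L"
  have "pair_holes X Y 0 0 0 (5 * L) \<le> holes X 0 m + holes Y 0 n"
    unfolding pair_holes_def by (rule add_mono; rule holes_mono) (use m n L_pos in auto)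
  then obtain S1 where S1: "S1 \<in> small_sumsets X Y (3 * 10 ^ 12 * 2 ^ J) (3 * 10 ^ 12 * (real R * 2 ^ J))"
      "holes S1 0 (4 * L) \<le> pair_holes X Y 0 0 0 L + pair_holes X Y 0 0 L (5 * L) / 10"
    using end_cover[OF R J L] holes_le by (meson order_trans)
  have "pair_holes X Y m n (- 5 * L) 0 \<le> holes X 0 m + holes Y 0 n"
    unfolding pair_holes_def by (rule add_mono; rule holes_mono) (use m n L_pos in auto)
  then obtain S2 where S2: "S2 \<in> small_sumsets X Y (3 * 10 ^ 12 * 2 ^ J) (3 * 10 ^ 12 * (real R * 2 ^ J))"
      "holes S2 ?M (m + n - 1) \<le> pair_holes X Y m n (- L) 0 + pair_holes X Y m n (- 5 * L) (- L) / 10"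
    using right_end_cover[OF R J L] holes_le by (meson order_trans)
  have "h \<le> holes X 0 m + holes Y 0 n"
    unfolding h_def by (rule add_mono; rule holes_mono) (use L_pos in auto)
  then have "h \<le> of_int L / 2" using holes_le L_pos by simp
  then obtain S3 where S3: "S3 \<in> small_sumsets X Y (2 * Q * real (middle_rounds Q) * real (2 ^ J))
      (4 * Q * real (middle_rounds Q) * real (R * 2 ^ J))" "holes S3 (4 * L) ?M \<le> h / 10"
    using middle_range_cover[OF Q _ _ L_eq m n h_def] R by auto
  obtain S4 where S4: "S4 \<in> small_sumsets X Y (3 * 10 ^ 12 * 2 ^ J + 3 * 10 ^ 12 * 2 ^ J)
      (3 * 10 ^ 12 * (real R * 2 ^ J) + 3 * 10 ^ 12 * (real R * 2 ^ J))" "S1 \<subseteq> S4" "S2 \<subseteq> S4"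
    using small_sumsets_Un[OF S1(1) S2(1)] by blast
  obtain W where W: "W \<in> small_sumsets X Y
      (3 * 10 ^ 12 * 2 ^ J + 3 * 10 ^ 12 * 2 ^ J + 2 * Q * real (middle_rounds Q) * real (2 ^ J))
      (3 * 10 ^ 12 * (real R * 2 ^ J) + 3 * 10 ^ 12 * (real R * 2 ^ J)
        + 4 * Q * real (middle_rounds Q) * real (R * 2 ^ J))" "S4 \<subseteq> W" "S3 \<subseteq> W"
    using small_sumsets_Un[OF S4(1) S3(1)] by blast
  have "holes W 0 (m + n - 1) = holes W 0 (4 * L) + holes W (4 * L) ?M + holes W ?M (m + n - 1)"
    using m n L_pos holes_split[of 0 "4 * L" "m + n - 1" W] holes_split[of "4 * L" ?M "m + n - 1" W] by auto
  also have "\<dots> \<le> holes S1 0 (4 * L) + holes S3 (4 * L) ?M + holes S2 ?M (m + n - 1)"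
    using W(2,3) S4(2,3) by (intro add_mono holes_antimono) auto
  also have "\<dots> \<le> holes X 0 m + holes Y 0 n"
    using S1(2) S2(2) S3(2) holes_ends_and_middle_le[of L m X] holes_ends_and_middle_le[of L n Y] m n L_pos
    by (simp add: h_def pair_holes_def add_divide_distrib)
  finally have "holes W 0 (m + n - 1) \<le> holes X 0 m + holes Y 0 n" .
  moreover have "W \<in> small_sumsets X Y (summand_cost Q * 2 ^ J) (summand_cost Q * (real R * 2 ^ J))"
    by (rule small_sumsets_mono[OF _ _ _ _ W(1)]) (use Q in \<open>simp_all add: summand_cost_def algebra_simps\<close>)
  ultimately show ?thesis by blast
qed

lemma nearly_full_sumset:
  fixes X Y :: "int set" and L m n :: int and R J :: nat
  assumes X: "X \<subseteq> {0..<m}" and Y: "Y \<subseteq> {0..<n}"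
    and Q: "1 \<le> Q" and R: "0 < R" and J: "0 < J" and L: "L = int (R * 4 ^ J)"
    and m: "10 * L \<le> m" "of_int m \<le> Q * of_int L" and n: "10 * L \<le> n" "of_int n \<le> Q * of_int L"
    and holes_le: "holes X 0 m + holes Y 0 n \<le> of_int L / 10000"
  shows "\<exists>S\<in>small_sumsets X Y (summand_cost Q * 2 ^ J) (summand_cost Q * (real R * 2 ^ J)).
     card X + card Y \<le> card S + 1"
proof -
  have "0 < L" using R by (simp add: L)
  obtain S where S: "S \<in> small_sumsets X Y (summand_cost Q * 2 ^ J) (summand_cost Q * (real R * 2 ^ J))"
      "holes S 0 (m + n - 1) \<le> holes X 0 m + holes Y 0 n"
    using nearly_full_cover[OF Q R J L m n holes_le] by blast
  have "card (S \<inter> {0..<m + n - 1}) \<le> card S" using small_sumsets_finite[OF S(1)] by (intro card_mono) auto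
  moreover have "real (card (S \<inter> {0..<m + n - 1})) = of_int (m + n - 1) - holes S 0 (m + n - 1)"
    using card_Int_interval[of 0 "m + n - 1" S] m n \<open>0 < L\<close> by simp
  moreover have "real (card X) = of_int m - holes X 0 m" "real (card Y) = of_int n - holes Y 0 n"
    using card_subset_interval[OF X] card_subset_interval[OF Y] m n \<open>0 < L\<close> by simp_all
  ultimately have "real (card X + card Y) \<le> real (card S + 1)" using S(2) by simp
  then have "card X + card Y \<le> card S + 1" by (simp only: of_nat_le_iff)
  with S(1) show ?thesis by blast
qed

section \<open>Few summands suffice\<close>

lemma exists_balanced_exponent:
  fixes D c :: real and N :: nat
  assumes D: "0 \<le> D" "2 * D \<le> c" and N: "800 \<le> N"
  obtains J where "0 < J" "D * 2 ^ J \<le> c" "200 * 4 ^ J \<le> N" "c < 2 * (D * 2 ^ J) \<or> N < 800 * 4 ^ J"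
proof -
  define fits where "fits = (\<lambda>j. D * 2 ^ j \<le> c \<and> 200 * 4 ^ j \<le> N)"
  define J where "J = Greatest fits"
  have bound: "j \<le> N" if "fits j" for j
  proof -
    have "j < 2 ^ j" by (rule less_exp)
    also have "(2::nat) ^ j \<le> 4 ^ j" by (intro power_mono) auto
    finally show ?thesis using that by (simp add: fits_def)
  qed
  have "fits 1" using D N by (simp add: fits_def mult.commute)
  then have "fits J" "1 \<le> J"
    unfolding J_def using GreatestI_nat[of fits 1 N] Greatest_le_nat[of fits 1 N] bound by auto
  moreover have "\<not> fits (Suc J)" using Greatest_le_nat[of fits "Suc J" N] bound by (auto simp: J_def)
  ultimately show thesis by (intro that[of J]) (auto simp: fits_def)
qed

text \<open>The length scale \<open>R 4\<^sup>J\<close> is of order \<open>N\<close>, while blocks of length \<open>2\<^sup>J\<close> and residue classes with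
  \<open>R 2\<^sup>J\<close> elements fit into \<open>c\<^sub>1\<close> and \<open>c\<^sub>2\<close> summands.\<close>

lemma exists_balanced_scale:
  fixes D c\<^sub>1 c\<^sub>2 :: real and N :: nat
  assumes D: "0 < D" "2 * D \<le> c\<^sub>1" and c: "c\<^sub>1 \<le> c\<^sub>2" and N: "800 \<le> N" and prod: "D\<^sup>2 * real N \<le> c\<^sub>1 * c\<^sub>2"
  obtains R J where "0 < R" "0 < J" "100 * (R * 4 ^ J) \<le> N" "N \<le> 200 * (R * 4 ^ J)"
    "D * 2 ^ J \<le> c\<^sub>1" "D / 8 * (real R * 2 ^ J) \<le> c\<^sub>2"
proof -
  obtain J where J: "0 < J" "D * 2 ^ J \<le> c\<^sub>1" "200 * 4 ^ J \<le> N"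
    and maximal: "c\<^sub>1 < 2 * (D * 2 ^ J) \<or> N < 800 * 4 ^ J"
    using exists_balanced_exponent[OF _ D(2) N] D by auto
  define R where "R = N div (100 * 4 ^ J)"
  have "R * (100 * 4 ^ J) + N mod (100 * 4 ^ J) = N" unfolding R_def by (rule div_mult_mod_eq)
  moreover have "N mod (100 * 4 ^ J) < 100 * 4 ^ J" by simp
  ultimately have R: "100 * (R * 4 ^ J) \<le> N" "N < 100 * (R * 4 ^ J) + 100 * 4 ^ J" by linarith+
  have "0 < R" using J(3) by (simp add: R_def div_greater_zero_iff)
  then have "4 ^ J \<le> R * 4 ^ J" by simp
  then have N_le: "N \<le> 200 * (R * 4 ^ J)" using R(2) by linarith
  have "D / 8 * (real R * 2 ^ J) \<le> c\<^sub>2" using maximal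
  proof
    assume "N < 800 * 4 ^ J"
    then have "R * 4 ^ J < 8 * 4 ^ J" using R(1) by linarith
    then have "R \<le> 8" by simp
    then have "D / 8 * (real R * 2 ^ J) \<le> D / 8 * (8 * 2 ^ J)"
      using D by (intro mult_left_mono mult_right_mono) auto
    then show ?thesis using J(2) c by simp
  next
    assume c_less: "c\<^sub>1 < 2 * (D * 2 ^ J)"
    have "(4::real) ^ J = 2 ^ J * 2 ^ J" by (simp flip: power_mult_distrib)
    then have "(D * 2 ^ J) * (100 * D * (real R * 2 ^ J)) = D\<^sup>2 * real (100 * (R * 4 ^ J))"
      by (simp add: power2_eq_square)
    also have "\<dots> \<le> D\<^sup>2 * real N" using R(1) by (intro mult_left_mono of_nat_mono) auto
    also have "\<dots> \<le> c\<^sub>1 * c\<^sub>2" by (rule prod)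
    also have "\<dots> \<le> 2 * (D * 2 ^ J) * c\<^sub>2" using c_less c D by (intro mult_right_mono) auto
    also have "\<dots> = (D * 2 ^ J) * (2 * c\<^sub>2)" by simp
    finally have "100 * D * (real R * 2 ^ J) \<le> 2 * c\<^sub>2" using D by (subst (asm) mult_le_cancel_left_pos) auto
    moreover have "0 \<le> D * (real R * 2 ^ J)" using D by simp
    ultimately show ?thesis by simp
  qed
  then show thesis using J R(1) N_le \<open>0 < R\<close> by (intro that[of R J])
qed

lemma exists_scale_within_budget:
  fixes C M :: real and N c\<^sub>1 c\<^sub>2 :: nat
  assumes C: "1 \<le> C" and c: "1 \<le> c\<^sub>1" "c\<^sub>1 \<le> c\<^sub>2" "c\<^sub>1 \<le> N" "real c\<^sub>2 \<le> M" and N: "real N \<le> 2 * M"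
    and prod: "1000 * C\<^sup>2 * M \<le> real (c\<^sub>1 * c\<^sub>2)"
  obtains R J where "0 < R" "0 < J" "100 * (R * 4 ^ J) \<le> N" "N \<le> 200 * (R * 4 ^ J)"
    "C * 2 ^ J \<le> real c\<^sub>1" "C * (real R * 2 ^ J) \<le> real c\<^sub>2"
proof -
  have "1000 * C\<^sup>2 * real c\<^sub>2 \<le> 1000 * C\<^sup>2 * M" using c by (intro mult_left_mono) auto
  also have "\<dots> \<le> real c\<^sub>1 * real c\<^sub>2" using prod by simp
  finally have "1000 * C\<^sup>2 \<le> real c\<^sub>1" using c by simp
  moreover have "C \<le> C\<^sup>2" using C by (simp add: power2_eq_square)
  ultimately have c\<^sub>1: "2 * (8 * C) \<le> real c\<^sub>1" "800 \<le> real c\<^sub>1" using C by linarith+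
  have "(8 * C)\<^sup>2 * real N \<le> 64 * C\<^sup>2 * (2 * M)"
    using mult_left_mono[OF N, of "64 * C\<^sup>2"] by (simp add: power_mult_distrib)
  also have "\<dots> \<le> 1000 * C\<^sup>2 * M"
    using c by (simp add: mult_right_mono)
  also have "\<dots> \<le> real c\<^sub>1 * real c\<^sub>2" using prod by simp
  finally have "(8 * C)\<^sup>2 * real N \<le> real c\<^sub>1 * real c\<^sub>2" .
  then obtain R J where RJ: "0 < R" "0 < J" "100 * (R * 4 ^ J) \<le> N" "N \<le> 200 * (R * 4 ^ J)"
      and fits: "8 * C * 2 ^ J \<le> real c\<^sub>1" "8 * C / 8 * (real R * 2 ^ J) \<le> real c\<^sub>2"
    using exists_balanced_scale[OF _ c\<^sub>1(1), of "real c\<^sub>2" N] c c\<^sub>1(2) C by auto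
  have "C * 2 ^ J \<le> 8 * C * 2 ^ J" using C by simp
  then show thesis using RJ fits by (intro that[of R J]) auto
qed

lemma summand_cost_ge_1: "1 \<le> Q \<Longrightarrow> 1 \<le> summand_cost Q"
  by (simp add: summand_cost_def add_increasing2)

lemma few_summands_ordered:
  fixes X Y :: "int set" and \<beta> :: real and m n c\<^sub>1 c\<^sub>2 :: nat
  assumes X: "X \<subseteq> {0..<int m}" and Y: "Y \<subseteq> {0..<int n}"
    and c\<^sub>1: "1 \<le> c\<^sub>1" "c\<^sub>1 \<le> card X" and c\<^sub>2: "c\<^sub>2 \<le> card Y" and ordered: "c\<^sub>1 \<le> c\<^sub>2"
    and prod: "1000 * (summand_cost (200 * \<beta>))\<^sup>2 * real (max (card X) (card Y)) \<le> real (c\<^sub>1 * c\<^sub>2)"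
    and \<beta>: "1 \<le> \<beta>" "real m \<le> \<beta> * real n" "real n \<le> \<beta> * real m"
    and holes_X: "holes X 0 (int m) \<le> 1 / 4000000 * real (min m n)"
    and holes_Y: "holes Y 0 (int n) \<le> 1 / 4000000 * real (min m n)"
  shows "\<exists>X'\<subseteq>X. \<exists>Y'\<subseteq>Y. card X' = c\<^sub>1 \<and> card Y' = c\<^sub>2 \<and> card X + card Y \<le> card (X' + Y') + 1"
proof -
  define Q where "Q = 200 * \<beta>"
  define C where "C = summand_cost Q"
  define N where "N = min m n"
  have Q: "1 \<le> Q" using \<beta> by (simp add: Q_def)
  have finite: "finite X" "finite Y" using X Y by (auto intro: finite_subset)
  have "card X \<le> m" "card Y \<le> n" using card_mono[OF _ X] card_mono[OF _ Y] by simp_all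
  then have "c\<^sub>1 \<le> N" using c\<^sub>1 c\<^sub>2 ordered by (simp add: N_def)
  have "real (card X) = real m - holes X 0 (int m)" using card_subset_interval[OF X] by simp
  then have "real N \<le> 2 * real (max (card X) (card Y))" using holes_X by (simp add: N_def)
  moreover have "real c\<^sub>2 \<le> real (max (card X) (card Y))" using c\<^sub>2 by simp
  ultimately obtain R J where RJ: "0 < R" "0 < J"
    and N_bounds: "100 * (R * 4 ^ J) \<le> N" "N \<le> 200 * (R * 4 ^ J)"
      and fits: "C * 2 ^ J \<le> real c\<^sub>1" "C * (real R * 2 ^ J) \<le> real c\<^sub>2"
    using exists_scale_within_budget[OF summand_cost_ge_1[OF Q] c\<^sub>1(1) ordered \<open>c\<^sub>1 \<le> N\<close> _ _ prod[folded Q_def]]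
    unfolding C_def by metis
  define L where "L = int (R * 4 ^ J)"
  have "10 * (R * 4 ^ J) \<le> N" using N_bounds(1) by linarith
  then have "int (10 * (R * 4 ^ J)) \<le> int N" by (simp only: of_nat_le_iff)
  then have L_le: "10 * L \<le> int m" "10 * L \<le> int n" by (simp_all add: L_def N_def)
  have "real N \<le> real (200 * (R * 4 ^ J))" using N_bounds(2) by (simp only: of_nat_le_iff)
  then have N_le: "real N \<le> 200 * of_int L" by (simp add: L_def)
  have "real m \<le> \<beta> * real N" "real n \<le> \<beta> * real N"
    using \<beta> mult_right_mono[OF \<beta>(1), of "real m"] mult_right_mono[OF \<beta>(1), of "real n"]
    by (auto simp: N_def min_def)
  moreover have "\<beta> * real N \<le> Q * of_int L" using \<beta> mult_left_mono[OF N_le, of \<beta>] by (simp add: Q_def)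
  ultimately have mn_le: "of_int (int m) \<le> Q * of_int L" "of_int (int n) \<le> Q * of_int L" by simp_all
  have "holes X 0 (int m) + holes Y 0 (int n) \<le> of_int L / 10000"
    using holes_X holes_Y N_le by (simp add: N_def)
  then obtain S where S: "S \<in> small_sumsets X Y (C * 2 ^ J) (C * (real R * 2 ^ J))"
      "card X + card Y \<le> card S + 1"
    using nearly_full_sumset[OF X Y Q RJ L_def L_le(1) mn_le(1) L_le(2) mn_le(2)] unfolding C_def by blast
  obtain X' Y' where XY': "X' \<subseteq> X" "Y' \<subseteq> Y" "card X' = c\<^sub>1" "card Y' = c\<^sub>2" "S \<subseteq> X' + Y'"
    using small_sumsets_extend[OF S(1) finite fits(1) c\<^sub>1(2) fits(2) c\<^sub>2] by blast
  then have "card S \<le> card (X' + Y')"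
    using finite by (intro card_mono finite_set_plus) (auto intro: finite_subset)
  then show ?thesis using S(2) XY' by (intro exI[of _ X'] conjI exI[of _ Y']) auto
qed

lemma few_summands:
  fixes X Y :: "int set" and \<beta> :: real and m n c\<^sub>1 c\<^sub>2 :: nat
  assumes X: "X \<subseteq> {0..<int m}" and Y: "Y \<subseteq> {0..<int n}"
    and c\<^sub>1: "1 \<le> c\<^sub>1" "c\<^sub>1 \<le> card X" and c\<^sub>2: "1 \<le> c\<^sub>2" "c\<^sub>2 \<le> card Y"
    and prod: "1000 * (summand_cost (200 * \<beta>))\<^sup>2 * real (max (card X) (card Y)) \<le> real (c\<^sub>1 * c\<^sub>2)"
    and \<beta>: "1 \<le> \<beta>" "real m \<le> \<beta> * real n" "real n \<le> \<beta> * real m"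
    and holes_X: "holes X 0 (int m) \<le> 1 / 4000000 * real (min m n)"
    and holes_Y: "holes Y 0 (int n) \<le> 1 / 4000000 * real (min m n)"
  shows "\<exists>X'\<subseteq>X. \<exists>Y'\<subseteq>Y. card X' = c\<^sub>1 \<and> card Y' = c\<^sub>2 \<and> card X + card Y \<le> card (X' + Y') + 1"
proof (cases "c\<^sub>1 \<le> c\<^sub>2")
  case True
  show ?thesis by (rule few_summands_ordered[OF X Y c\<^sub>1 c\<^sub>2(2) True prod \<beta> holes_X holes_Y])
next
  case False
  have "\<exists>Y'\<subseteq>Y. \<exists>X'\<subseteq>X. card Y' = c\<^sub>2 \<and> card X' = c\<^sub>1 \<and> card Y + card X \<le> card (Y' + X') + 1"
    using False prod holes_X holes_Y
    by (intro few_summands_ordered[OF Y X c\<^sub>2 c\<^sub>1(2) _ _ \<beta>(1,3,2)])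
       (simp_all add: max.commute min.commute mult.commute)
  then show ?thesis by (metis add.commute)
qed

section \<open>Transfer to residues\<close>

lemma inj_on_add_mod:
  fixes a p :: int
  shows "inj_on (\<lambda>i. (a + i) mod p) {0..<p}"
proof (rule inj_onI)
  fix i j assume ij: "i \<in> {0..<p}" "j \<in> {0..<p}" and "(a + i) mod p = (a + j) mod p"
  then have "((a + i) - a) mod p = ((a + j) - a) mod p" by (intro mod_diff_cong) auto
  then show "i = j" using ij by simp
qed

lemma residue_interval_eq_image:
  assumes I: "residue_interval p I" and card_I: "card I < p"
  obtains a where "I = (\<lambda>i. (a + i) mod int p) ` {0..<int (card I)}"
proof -
  from I obtain a m where "I = (\<lambda>i. (a + int i) mod int p) ` {..<m}" unfolding residue_interval_def by blast
  then have I_eq: "I = (\<lambda>i. (a + i) mod int p) ` {0..<int m}"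
    by (simp only: image_int_atLeastLessThan[of 0 m, simplified, symmetric] image_image lessThan_atLeast0)
  have "m < p"
  proof (rule ccontr)
    assume "\<not> m < p"
    then have "(\<lambda>i. (a + i) mod int p) ` {0..<int p} \<subseteq> I" unfolding I_eq by (intro image_mono) auto
    then have "card ((\<lambda>i. (a + i) mod int p) ` {0..<int p}) \<le> card I" by (intro card_mono) (auto simp: I_eq)
    then show False using card_I by (simp add: card_image[OF inj_on_add_mod])
  qed
  then have "card I = m"
    unfolding I_eq by (subst card_image) (auto intro: inj_on_subset[OF inj_on_add_mod])
  with I_eq show thesis by (intro that[of a]) simp
qed

lemma residue_interval_subset_lift:
  assumes "residue_interval p I" "card I < p" "X \<subseteq> I"
  obtains a A where "A \<subseteq> {0..<int (card I)}" "X = (\<lambda>i. (a + i) mod int p) ` A"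
    "holes A 0 (int (card I)) = real (card (I - X))"
proof -
  obtain a where I: "I = (\<lambda>i. (a + i) mod int p) ` {0..<int (card I)}"
    by (rule residue_interval_eq_image[OF assms(1,2)])
  define f where "f = (\<lambda>i. (a + i) mod int p)"
  define A where "A = {i \<in> {0..<int (card I)}. f i \<in> X}"
  have "inj_on f ({0..<int (card I)} - A)"
    unfolding f_def using assms(2) by (intro inj_on_subset[OF inj_on_add_mod]) auto
  moreover have "f ` ({0..<int (card I)} - A) = I - X" using I by (auto simp: A_def f_def)
  ultimately have "card (I - X) = card ({0..<int (card I)} - A)" by (metis card_image)
  moreover have "X \<subseteq> f ` {0..<int (card I)}"
    unfolding f_def using assms(3) equalityD1[OF I] by (rule subset_trans)
  then have "X = f ` A" by (auto simp: A_def)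
  moreover have "A \<subseteq> {0..<int (card I)}" by (auto simp: A_def)
  ultimately show thesis using that[of A a] by (simp add: f_def holes_def)
qed

lemma residue_sumset_image:
  "(\<lambda>i. (a + i) mod p) ` A <+>\<^bsub>residue_ring p\<^esub> (\<lambda>j. (b + j) mod p) ` B
     = (\<lambda>s. (a + b + s) mod p) ` (A + B)"
proof -
  have "((a + i) mod p + (b + j) mod p) mod p = (a + b + (i + j)) mod p" for i j :: int
    by (simp add: mod_add_eq algebra_simps)
  then show ?thesis by (force simp: set_add_def' residue_ring_def set_plus_def)
qed

lemma few_summands_residues:
  fixes p c\<^sub>1 c\<^sub>2 :: nat and I J X Y :: "int set" and \<beta> :: real
  assumes I: "residue_interval p I" and J: "residue_interval p J" and X: "X \<subseteq> I" and Y: "Y \<subseteq> J"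
    and c\<^sub>1: "1 \<le> c\<^sub>1" "c\<^sub>1 \<le> card X" and c\<^sub>2: "1 \<le> c\<^sub>2" "c\<^sub>2 \<le> card Y"
    and prod: "1000 * (summand_cost (200 * \<beta>))\<^sup>2 * real (max (card X) (card Y)) \<le> real (c\<^sub>1 * c\<^sub>2)"
    and \<beta>: "1 \<le> \<beta>" "real (card I) \<le> \<beta> * real (card J)" "real (card J) \<le> \<beta> * real (card I)"
    and IJ: "card I + card J \<le> p"
    and missing: "real (max (card (I - X)) (card (J - Y))) \<le> 1 / 4000000 * real (min (card I) (card J))"
  shows "\<exists>X' \<in> [X]\<^bsup>c\<^sub>1\<^esup>. \<exists>Y' \<in> [Y]\<^bsup>c\<^sub>2\<^esup>. card X + card Y - 1 \<le> card (X' <+>\<^bsub>residue_ring (int p)\<^esub> Y')"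
proof -
  have "finite I" "finite J" using I J by (auto simp: residue_interval_def)
  then have "card X \<le> card I" "card Y \<le> card J" using X Y by (auto intro: card_mono)
  then have less: "card I < p" "card J < p" using c\<^sub>1 c\<^sub>2 IJ by linarith+
  obtain a A where A: "A \<subseteq> {0..<int (card I)}" "X = (\<lambda>i. (a + i) mod int p) ` A"
    "holes A 0 (int (card I)) = real (card (I - X))" by (rule residue_interval_subset_lift[OF I less(1) X])
  obtain b B where B: "B \<subseteq> {0..<int (card J)}" "Y = (\<lambda>i. (b + i) mod int p) ` B"
    "holes B 0 (int (card J)) = real (card (J - Y))" by (rule residue_interval_subset_lift[OF J less(2) Y])
  have card_image_mod: "card ((\<lambda>i. (d + i) mod int p) ` S) = card S" if "S \<subseteq> {0..<int p}" for d S
    using that by (intro card_image inj_on_subset[OF inj_on_add_mod])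
  have below_p: "A \<subseteq> {0..<int p}" "B \<subseteq> {0..<int p}" using A(1) B(1) less by fastforce+
  then have card_eq: "card X = card A" "card Y = card B" by (simp_all add: A(2) B(2) card_image_mod)
  have "\<exists>A'\<subseteq>A. \<exists>B'\<subseteq>B. card A' = c\<^sub>1 \<and> card B' = c\<^sub>2 \<and> card A + card B \<le> card (A' + B') + 1"
    using c\<^sub>1 c\<^sub>2 prod missing A(3) B(3)
    by (intro few_summands[OF A(1) B(1) _ _ _ _ _ \<beta>]) (simp_all add: card_eq)
  then obtain A' B' where A'B': "A' \<subseteq> A" "B' \<subseteq> B" "card A' = c\<^sub>1" "card B' = c\<^sub>2"
    "card A + card B \<le> card (A' + B') + 1" by blast
  define X' where "X' = (\<lambda>i. (a + i) mod int p) ` A'"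
  define Y' where "Y' = (\<lambda>i. (b + i) mod int p) ` B'"
  have "A' + B' \<subseteq> {0..<int p}"
  proof
    fix s assume "s \<in> A' + B'"
    then obtain x y where "s = x + y" "x \<in> {0..<int (card I)}" "y \<in> {0..<int (card J)}"
      using A'B'(1,2) A(1) B(1) by (blast elim: set_plus_elim)
    then show "s \<in> {0..<int p}" using IJ by auto
  qed
  then have "card (X' <+>\<^bsub>residue_ring (int p)\<^esub> Y') = card (A' + B')"
    unfolding X'_def Y'_def residue_sumset_image by (rule card_image_mod)
  moreover have "card X' = c\<^sub>1" "card Y' = c\<^sub>2"
    using A'B' below_p unfolding X'_def Y'_def by (simp_all add: card_image_mod)
  moreover have "X' \<subseteq> X" "Y' \<subseteq> Y" using A'B'(1,2) unfolding X'_def Y'_def A(2) B(2) by blast+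
  moreover have "finite X" "finite Y" using c\<^sub>1 c\<^sub>2 by (auto intro: card_ge_0_finite)
  ultimately show ?thesis
    using A'B'(5) card_eq by (intro bexI[of _ X'] bexI[of _ Y']) (auto simp: nsets_def intro: finite_subset)
qed

theorem theorem7:
  shows "\<exists>\<gamma>::real. \<gamma> > 0 \<and> (\<forall>\<alpha>::real. \<alpha> > 0 \<longrightarrow> (\<exists>c::real.
    \<forall>(p::nat) (I::int set) (J::int set) (X::int set) (Y::int set) (c\<^sub>1::nat) (c\<^sub>2::nat).
      prime p \<longrightarrow>
      residue_interval p I \<longrightarrow> residue_interval p J \<longrightarrow>
      X \<subseteq> I \<longrightarrow> Y \<subseteq> J \<longrightarrow>
      1 \<le> c\<^sub>1 \<and> c\<^sub>1 \<le> card X \<longrightarrow> 1 \<le> c\<^sub>2 \<and> c\<^sub>2 \<le> card Y \<longrightarrow>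
      real (c\<^sub>1 * c\<^sub>2) \<ge> c * real (max (card X) (card Y)) \<longrightarrow>
      \<alpha> * real (card J) \<le> real (card I) \<and> real (card I) \<le> inverse \<alpha> * real (card J) \<longrightarrow>
      card I + card J \<le> p \<longrightarrow>
      real (max (card (I - X)) (card (J - Y))) \<le> \<gamma> * real (min (card I) (card J)) \<longrightarrow>
      (\<exists>X' \<in> [X]\<^bsup>c\<^sub>1\<^esup>. \<exists>Y' \<in> [Y]\<^bsup>c\<^sub>2\<^esup>.
         card (X' <+>\<^bsub>residue_ring (int p)\<^esub> Y') \<ge> card X + card Y - 1)))"
proof (rule exI[of _ "1 / 4000000"], intro conjI allI impI, goal_cases)
  case (2 \<alpha>)
  define \<beta> where "\<beta> = max 1 (inverse \<alpha>)"
  show ?case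
  proof (rule exI[of _ "1000 * (summand_cost (200 * \<beta>))\<^sup>2"], intro allI impI, elim conjE, goal_cases)
    case (1 p I J X Y c\<^sub>1 c\<^sub>2)
    have "inverse \<alpha> * real k \<le> \<beta> * real k" for k by (intro mult_right_mono) (auto simp: \<beta>_def)
    moreover have "real (card J) \<le> inverse \<alpha> * real (card I)"
      using 1 2 by (simp add: field_simps)
    ultimately have "real (card I) \<le> \<beta> * real (card J)" "real (card J) \<le> \<beta> * real (card I)"
      using 1 order_trans by blast+
    moreover have "1 \<le> \<beta>" by (simp add: \<beta>_def)
    ultimately show ?case using 1 by (intro few_summands_residues)
  qed
qed simp

end
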